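(* Let $d\geq 1$ be an integer, let $s>\frac32$ and let $v_0\in H^s(\mathbb{R})$. Assume that for some point $x_0\in\mathbb{R}$ $$v_0'(x_0)<-\frac{1}{\sqrt d}\,|v_0(x_0)|.$$ Then the corresponding solution $v$ of the Cauchy problem $$\partial_tv+d\,v\,\partial_xv=-\partial_x(1-d\,\partial_x^2)^{-1}\Big(d\,v^2+\frac{d^2}{2}(\partial_xv)^2\Big),\quad (t,x)\in\mathbb{R}^+\times\mathbb{R},\qquad v(0,x)=v_0(x),$$ blows up in finite time, i.e. its maximal existence time $T$ is finite.
   Context: Here $(1-d\,\partial_x^2)^{-1}f=p_d*f$ with $p_d(x)=\frac{1}{2\sqrt d}\,e^{-|x|/\sqrt d}$. For $v_0\in H^s(\mathbb{R})$ with $s>\frac32$, the Cauchy problem is locally well posed: there is a unique strong solution $v\in C([0,T);H^s(\mathbb{R}))\cap C^1([0,T);H^{s-1}(\mathbb{R}))$ on a maximal time interval $[0,T)$, $0<T\le\infty$; this is "the corresponding solution" and $T$ is its maximal existence time. Since $s>\frac32$, $v_0$ is (identified with) a $C^1$ function, so $v_0(x_0)$ and $v_0'(x_0)$ make sense pointwise. *)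

theory Defs
  imports "HOL-Analysis.Analysis"
begin

definition square_integrable :: "(real \<Rightarrow> complex) \<Rightarrow> bool" where
  "square_integrable f \<longleftrightarrow>
     f \<in> borel_measurable lborel \<and> integrable lborel (\<lambda>x. (cmod (f x))\<^sup>2)"

(* Plancherel's definition: g is the limit in L^2 of the Fourier transforms of the
   truncations of f, with kernel exp (- i xi x). By Plancherel's theorem such a g exists
   for every f in L^2, and it is unique almost everywhere. *)
definition L2_fourier :: "(real \<Rightarrow> complex) \<Rightarrow> (real \<Rightarrow> complex) \<Rightarrow> bool" where
  "L2_fourier f g \<longleftrightarrow>
     square_integrable f \<and> square_integrable g \<and>
     ((\<lambda>R::real. \<integral>\<^sup>+ \<xi>. ennreal ((cmod (g \<xi> -
          (LINT x:{-R..R}|lborel. cis (- (\<xi> * x)) * f x)))\<^sup>2) \<partial>lborel) \<longlongrightarrow> 0) at_top"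

(* For s \<ge> 0, the real-valued functions whose almost-everywhere class is in H^s.
   Only exponents s > 1/2 are used. *)
definition sobolev :: "real \<Rightarrow> (real \<Rightarrow> real) set" where
  "sobolev s = {f. \<exists>g. L2_fourier (\<lambda>x. complex_of_real (f x)) g \<and>
     integrable lborel (\<lambda>\<xi>. (1 + \<xi>\<^sup>2) powr s * (cmod (g \<xi>))\<^sup>2)}"

(* Meaningful only on sobolev s; there the choice of g does not matter. *)
definition sobolev_norm :: "real \<Rightarrow> (real \<Rightarrow> real) \<Rightarrow> real" where
  "sobolev_norm s f =
     (let g = (SOME g. L2_fourier (\<lambda>x. complex_of_real (f x)) g)
      in sqrt (LINT \<xi>|lborel. (1 + \<xi>\<^sup>2) powr s * (cmod (g \<xi>))\<^sup>2))"

definition continuous_into_sobolev :: "real \<Rightarrow> real set \<Rightarrow> (real \<Rightarrow> real \<Rightarrow> real) \<Rightarrow> bool" where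
  "continuous_into_sobolev s I u \<longleftrightarrow>
     (\<forall>t\<in>I. u t \<in> sobolev s \<and>
        ((\<lambda>\<tau>. sobolev_norm s (\<lambda>x. u \<tau> x - u t x)) \<longlongrightarrow> 0) (at t within I))"

(* w is the time derivative of u : I \<rightarrow> H^s (one-sided at an end point of I). *)
definition has_sobolev_time_derivative ::
  "real \<Rightarrow> real set \<Rightarrow> (real \<Rightarrow> real \<Rightarrow> real) \<Rightarrow> (real \<Rightarrow> real \<Rightarrow> real) \<Rightarrow> bool" where
  "has_sobolev_time_derivative s I u w \<longleftrightarrow>
     (\<forall>t\<in>I. u t \<in> sobolev s \<and> w t \<in> sobolev s \<and>
        ((\<lambda>\<tau>. sobolev_norm s (\<lambda>x. (u \<tau> x - u t x) / (\<tau> - t) - w t x)) \<longlongrightarrow> 0)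
          (at t within I))"

definition p_kernel :: "nat \<Rightarrow> real \<Rightarrow> real" where
  "p_kernel d x = 1 / (2 * sqrt (real d)) * exp (- \<bar>x\<bar> / sqrt (real d))"

(* The operator (1 - d \<partial>\<^sub>x\<^sup>2)^(-1), i.e. convolution with p_kernel d. *)
definition helmholtz_inverse :: "nat \<Rightarrow> (real \<Rightarrow> real) \<Rightarrow> real \<Rightarrow> real" where
  "helmholtz_inverse d f x = (LINT y|lborel. p_kernel d (x - y) * f y)"

definition time_interval :: "ereal \<Rightarrow> real set" where
  "time_interval T = {t. 0 \<le> t \<and> ereal t < T}"

(* v is in C([0,T); H^s) and C^1([0,T); H^(s-1)), with time derivative w, and the equation
   holds in H^(s-1), i.e. almost everywhere in x for each t. Each v t is the C^1
   representative of its class, which exists for s > 3/2, so that the space derivatives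
   are classical. *)
definition strong_solution ::
  "nat \<Rightarrow> real \<Rightarrow> (real \<Rightarrow> real) \<Rightarrow> ereal \<Rightarrow> (real \<Rightarrow> real \<Rightarrow> real) \<Rightarrow> bool" where
  "strong_solution d s v0 T v \<longleftrightarrow>
     0 < T \<and>
     (\<forall>t\<in>time_interval T. v t C1_differentiable_on UNIV) \<and>
     continuous_into_sobolev s (time_interval T) v \<and>
     v 0 = v0 \<and>
     (\<exists>w. has_sobolev_time_derivative (s - 1) (time_interval T) v w \<and>
        continuous_into_sobolev (s - 1) (time_interval T) w \<and>
        (\<forall>t\<in>time_interval T. AE x in lborel.
           w t x + real d * v t x * deriv (v t) x =
           - deriv (helmholtz_inverse d
               (\<lambda>y. real d * (v t y)\<^sup>2 + (real d)\<^sup>2 / 2 * (deriv (v t) y)\<^sup>2)) x))"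

definition maximal_strong_solution ::
  "nat \<Rightarrow> real \<Rightarrow> (real \<Rightarrow> real) \<Rightarrow> ereal \<Rightarrow> (real \<Rightarrow> real \<Rightarrow> real) \<Rightarrow> bool" where
  "maximal_strong_solution d s v0 T v \<longleftrightarrow>
     strong_solution d s v0 T v \<and>
     \<not> (\<exists>T' v'. T < T' \<and> strong_solution d s v0 T' v' \<and>
          (\<forall>t\<in>time_interval T. v' t = v t))"

end

theory Submission
  imports Defs "HOL-Probability.Probability"
begin

text \<open>Put \<open>c = sqrt d\<close> and let \<open>f = c\<^sup>2 v\<^sup>2 + (c\<^sup>4 / 2) v\<^sub>x\<^sup>2\<close> be the quadratic source. The function
\<open>(1 - c\<^sup>2 \<partial>\<^sub>x\<^sup>2)\<^sup>-\<^sup>1 f\<close> is the sum \<open>a + b\<close> of exponentially weighted averages of \<open>f\<close> over the left and the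
right half-line, and its space derivative is \<open>(b - a) / c\<close>. Along a characteristic
\<open>q' = c\<^sup>2 v(t, q)\<close> the value \<open>V = v(t, q)\<close> and the slope \<open>m = v\<^sub>x(t, q)\<close> therefore obey
\<open>V' = (a - b) / c\<close> and \<open>m' = V\<^sup>2 - (c\<^sup>2 / 2) m\<^sup>2 - (a + b) / c\<^sup>2\<close>. Each of the two averages
is at least \<open>c\<^sup>2 V\<^sup>2 / 4\<close>, separately (\<open>left_average_lower_bound\<close>). Hence \<open>A = V / c - m\<close> and
\<open>C = - V / c - m\<close> both satisfy \<open>A', C' \<ge> (c\<^sup>2 / 2) A C\<close>. The hypothesis on \<open>v\<^sub>0\<close> at \<open>x\<^sub>0\<close> says
precisely that \<open>A\<close> and \<open>C\<close> are positive at time 0 on the characteristic from \<open>x\<^sub>0\<close>. They remain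
positive, so \<open>1 / A + 1 / C\<close> is a positive quantity that decreases at least at the rate \<open>c\<^sup>2\<close>:
this is impossible for all time (\<open>coupled_growth_blowup\<close>, \<open>no_global_solution\<close>).

The delicate point is regularity. For \<open>s\<close> close to \<open>3/2\<close> the slope \<open>v\<^sub>x\<close> is merely continuous, so the
equation for \<open>m\<close> cannot be obtained by differentiating the evolution equation in \<open>x\<close>. The Sobolev
embedding, which is derived from Fourier inversion, turns convergence in \<open>H\<^sup>s\<close> into convergence of
\<open>v\<close> and \<open>v\<^sub>x\<close> uniformly in \<open>x\<close>, and convergence in \<open>H\<^sup>s\<^sup>-\<^sup>1\<close> of the time difference quotients into
uniform convergence to a continuous function (\<open>strong_solution_imp_classical_solution\<close>). This
suffices for the chain rule for \<open>t \<mapsto> v(t, q(t) + h)\<close>, with \<open>h\<close> fixed. The quotient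
\<open>\<mu>\<^sub>h = (v(t, q + h) - v(t, q)) / h\<close> then solves a differential equation in which no second derivative
of \<open>v\<close> occurs, because the force is differentiable in \<open>x\<close>; letting \<open>h \<rightarrow> 0\<close> under the time integral gives
the equation for \<open>m\<close> (\<open>slope_along_characteristic\<close>).\<close>

section \<open>Fourier inversion for square-integrable functions\<close>

lemma square_integrable_measurable [measurable_dest]:
  "square_integrable f \<Longrightarrow> f \<in> borel_measurable borel"
  by (simp add: square_integrable_def)

lemma integrable_mult_square_integrable:
  assumes "square_integrable f" "square_integrable g"
  shows "integrable lborel (\<lambda>x. f x * g x)"
proof (rule Bochner_Integration.integrable_bound)
  show "integrable lborel (\<lambda>x. (cmod (f x))\<^sup>2 + (cmod (g x))\<^sup>2)"
    using assms by (simp add: square_integrable_def)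
  show "(\<lambda>x. f x * g x) \<in> borel_measurable lborel"
    using assms[THEN square_integrable_measurable] by simp
  have "cmod (f x) * cmod (g x) \<le> (cmod (f x))\<^sup>2 + (cmod (g x))\<^sup>2" for x
  proof -
    have "2 * (cmod (f x) * cmod (g x)) \<le> (cmod (f x))\<^sup>2 + (cmod (g x))\<^sup>2"
      using sum_squares_bound[of "cmod (f x)" "cmod (g x)"] by simp
    moreover have "0 \<le> cmod (f x) * cmod (g x)"
      by simp
    ultimately show ?thesis
      by linarith
  qed
  then show "AE x in lborel. norm (f x * g x) \<le> norm ((cmod (f x))\<^sup>2 + (cmod (g x))\<^sup>2)"
    by (auto simp: norm_mult)
qed

lemma square_integrable_indicator_interval:
  "square_integrable (\<lambda>x. indicator {a..b::real} x)"
proof -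
  have "(\<lambda>x. (cmod (indicator {a..b} x))\<^sup>2) = (indicator {a..b} :: real \<Rightarrow> real)"
    by (auto simp: indicator_def)
  then show ?thesis
    by (auto simp: square_integrable_def integrable_indicator_iff emeasure_lborel_Icc_eq)
qed

lemma integrable_truncation:
  assumes "square_integrable f"
  shows "integrable lborel (\<lambda>x. indicator {a..b::real} x * f x)"
  by (rule integrable_mult_square_integrable[OF square_integrable_indicator_interval assms])

lemma integrable_gaussian_weight:
  assumes "\<sigma> > 0"
  shows "integrable lborel (\<lambda>\<xi>::real. exp (- (\<sigma> * \<xi>)\<^sup>2 / 2))"
proof -
  have "exp (- (\<sigma> * \<xi>)\<^sup>2 / 2) = sqrt (2 * pi) / \<sigma> * normal_density 0 (1 / \<sigma>) \<xi>" for \<xi>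
    using assms by (simp add: normal_density_def real_sqrt_divide power_mult_distrib field_simps)
  then show ?thesis
    using assms by (simp add: integrable_normal_density)
qed

text \<open>After rescaling this is the characteristic function of the standard normal distribution.\<close>

lemma fourier_gaussian:
  assumes "\<sigma> > 0"
  shows "(LINT \<xi>|lborel. cis (\<xi> * y) * complex_of_real (exp (- (\<sigma> * \<xi>)\<^sup>2 / 2)))
           = complex_of_real (2 * pi * normal_density 0 \<sigma> y)"
proof -
  have "(LINT \<xi>|lborel. cis (\<xi> * y) * complex_of_real (exp (- (\<sigma> * \<xi>)\<^sup>2 / 2)))
      = (1 / \<sigma>) *\<^sub>R (LINT \<eta>|lborel. cis (\<eta> / \<sigma> * y) * complex_of_real (exp (- \<eta>\<^sup>2 / 2)))"
    using assms
    by (subst lborel_integral_real_affine[where c = "1 / \<sigma>" and t = 0]) auto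
  also have "(LINT \<eta>|lborel. cis (\<eta> / \<sigma> * y) * complex_of_real (exp (- \<eta>\<^sup>2 / 2)))
      = sqrt (2 * pi) * (LINT \<eta>|lborel. std_normal_density \<eta> *\<^sub>R cis (\<eta> / \<sigma> * y))"
    by (subst integral_mult_right_zero[symmetric])
       (rule Bochner_Integration.integral_cong, auto simp: std_normal_density_def scaleR_conv_of_real)
  also have "(LINT \<eta>|lborel. std_normal_density \<eta> *\<^sub>R cis (\<eta> / \<sigma> * y))
      = char std_normal_distribution (y / \<sigma>)"
    unfolding char_def
    by (subst integral_density)
       (auto simp: cis_conv_exp mult_ac)
  also have "\<dots> = exp (- (y / \<sigma>)\<^sup>2 / 2)"
    by (simp add: char_std_normal_distribution)
  also have "(1 / \<sigma>) *\<^sub>R (sqrt (2 * pi) * complex_of_real (exp (- (y / \<sigma>)\<^sup>2 / 2)))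
      = complex_of_real (2 * pi * normal_density 0 \<sigma> y)"
  proof -
    have "(1 / \<sigma>) * (sqrt (2 * pi) * exp (- (y / \<sigma>)\<^sup>2 / 2)) = 2 * pi * normal_density 0 \<sigma> y"
      using assms by (simp add: normal_density_def real_sqrt_mult power_divide field_simps)
    then show ?thesis
      by (metis of_real_mult scaleR_conv_of_real)
  qed
  finally show ?thesis .
qed

lemma square_integrable_gaussian_weight:
  assumes "\<sigma> > 0"
  shows "square_integrable (\<lambda>\<xi>. cis (\<xi> * a) * complex_of_real (exp (- (\<sigma> * \<xi>)\<^sup>2 / 2)))"
proof -
  have "(exp (- (\<sigma> * \<xi>)\<^sup>2 / 2))\<^sup>2 = exp (- (sqrt 2 * \<sigma> * \<xi>)\<^sup>2 / 2)" for \<xi>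
    by (simp add: power_mult_distrib flip: exp_double)
  then have "integrable lborel (\<lambda>\<xi>. (exp (- (\<sigma> * \<xi>)\<^sup>2 / 2))\<^sup>2)"
    using integrable_gaussian_weight[of "sqrt 2 * \<sigma>"] assms by simp
  moreover have "continuous_on UNIV (\<lambda>\<xi>. cis (\<xi> * a) * complex_of_real (exp (- (\<sigma> * \<xi>)\<^sup>2 / 2)))"
    by (intro continuous_intros) auto
  ultimately show ?thesis
    by (simp add: square_integrable_def norm_mult borel_measurable_continuous_onI)
qed


text \<open>By the Cauchy-Schwarz inequality, the pairing with a fixed square-integrable function is
continuous for convergence in mean square. This is how the limit in the definition of the Fourier
transform is used.\<close>

lemma integral_mult_tendsto_of_L2_tendsto:
  fixes h :: "'i \<Rightarrow> real \<Rightarrow> complex" and F :: "'i filter"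
  assumes meas: "\<And>i. h i \<in> borel_measurable lborel"
    and phi: "square_integrable \<phi>"
    and lim: "((\<lambda>i. \<integral>\<^sup>+ x. ennreal ((cmod (h i x))\<^sup>2) \<partial>lborel) \<longlongrightarrow> 0) F"
  shows "((\<lambda>i. LINT x|lborel. h i x * \<phi> x) \<longlongrightarrow> 0) F"
proof -
  have [measurable]: "h i \<in> borel_measurable borel" for i
    using meas[of i] by simp
  have [measurable]: "\<phi> \<in> borel_measurable borel"
    using phi by (rule square_integrable_measurable)
  let ?I = "\<lambda>i. \<integral>\<^sup>+ x. ennreal ((cmod (h i x))\<^sup>2) \<partial>lborel"
  define K where "K = (\<integral>\<^sup>+ x. ennreal ((cmod (\<phi> x))\<^sup>2) \<partial>lborel)"
  have "K < \<infinity>"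
    using phi by (simp add: K_def square_integrable_def integrable_iff_bounded)
  have bound: "ennreal ((cmod (LINT x|lborel. h i x * \<phi> x))\<^sup>2) \<le> ?I i * K" for i
  proof -
    have "ennreal (cmod (LINT x|lborel. h i x * \<phi> x))
            \<le> (\<integral>\<^sup>+ x. ennreal (cmod (h i x * \<phi> x)) \<partial>lborel)"
    proof (cases "integrable lborel (\<lambda>x. h i x * \<phi> x)")
      case True
      then show ?thesis by (rule integral_norm_bound_ennreal)
    qed (simp add: not_integrable_integral_eq)
    then have "(ennreal (cmod (LINT x|lborel. h i x * \<phi> x)))\<^sup>2
            \<le> (\<integral>\<^sup>+ x. ennreal (cmod (h i x)) * ennreal (cmod (\<phi> x)) \<partial>lborel)\<^sup>2"
      by (intro power_mono) (simp_all add: norm_mult ennreal_mult)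
    also have "\<dots> \<le> (\<integral>\<^sup>+ x. (ennreal (cmod (h i x)))\<^sup>2 \<partial>lborel)
                    * (\<integral>\<^sup>+ x. (ennreal (cmod (\<phi> x)))\<^sup>2 \<partial>lborel)"
      by (rule Cauchy_Schwarz_nn_integral) measurable
    finally show ?thesis
      by (simp add: K_def ennreal_power)
  qed
  have "((\<lambda>i. ?I i * K) \<longlongrightarrow> 0) F"
    using ennreal_tendsto_cmult[OF \<open>K < \<infinity>\<close>[unfolded infinity_ennreal_def] lim]
    by (simp add: mult.commute)
  then have "((\<lambda>i. ennreal ((cmod (LINT x|lborel. h i x * \<phi> x))\<^sup>2)) \<longlongrightarrow> 0) F"
    by (rule tendsto_sandwich[OF _ _ tendsto_const, rotated 2]) (auto intro!: always_eventually bound)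
  then have "((\<lambda>i. (cmod (LINT x|lborel. h i x * \<phi> x))\<^sup>2) \<longlongrightarrow> 0) F"
    by (subst (asm) tendsto_ennreal_iff[where x = 0, simplified]) auto
  then have "((\<lambda>i. sqrt ((cmod (LINT x|lborel. h i x * \<phi> x))\<^sup>2)) \<longlongrightarrow> sqrt 0) F"
    by (rule tendsto_real_sqrt)
  then show ?thesis
    by (simp add: tendsto_norm_zero_iff)
qed

definition truncated_fourier :: "real \<Rightarrow> (real \<Rightarrow> complex) \<Rightarrow> real \<Rightarrow> complex" where
  "truncated_fourier R f \<xi> = (LINT x:{-R..R}|lborel. cis (- (\<xi> * x)) * f x)"

lemma borel_measurable_cis [measurable]: "cis \<in> borel_measurable borel"
  by (intro borel_measurable_continuous_onI continuous_intros)

lemma truncated_fourier_measurable [measurable]: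
  assumes "square_integrable f"
  shows "truncated_fourier R f \<in> borel_measurable borel"
proof -
  have [measurable]: "f \<in> borel_measurable borel"
    using assms by (rule square_integrable_measurable)
  show ?thesis
    unfolding truncated_fourier_def[abs_def] set_lebesgue_integral_def by measurable
qed

lemma norm_truncated_fourier_le:
  assumes "square_integrable f"
  shows "cmod (truncated_fourier R f \<xi>) \<le> (LINT x|lborel. cmod (indicator {-R..R} x * f x))"
proof -
  have "cmod (truncated_fourier R f \<xi>)
      \<le> (LINT x|lborel. cmod (indicator {-R..R} x *\<^sub>R (cis (- (\<xi> * x)) * f x)))"
    unfolding truncated_fourier_def set_lebesgue_integral_def by (rule integral_norm_bound)
  also have "\<dots> = (LINT x|lborel. cmod (indicator {-R..R} x * f x))"
    by (rule Bochner_Integration.integral_cong) (auto simp: norm_mult indicator_def)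
  finally show ?thesis .
qed

text \<open>A truncated square-integrable function is integrable, so Fubini's theorem moves the Fourier
transform from the truncation to the Gaussian.\<close>

lemma truncated_fourier_gaussian:
  fixes f :: "real \<Rightarrow> complex"
  assumes f: "square_integrable f" and "\<sigma> > 0"
  shows "(LINT \<xi>|lborel. truncated_fourier R f \<xi> *
            (cis (\<xi> * a) * complex_of_real (exp (- (\<sigma> * \<xi>)\<^sup>2 / 2))))
       = 2 * pi * (LINT x|lborel. indicator {-R..R} x * f x * complex_of_real (normal_density 0 \<sigma> (a - x)))"
proof -
  have [measurable]: "f \<in> borel_measurable borel"
    using f by (rule square_integrable_measurable)
  define w where "w = (\<lambda>\<xi>::real. exp (- (\<sigma> * \<xi>)\<^sup>2 / 2))"
  have w: "integrable lborel w"
    unfolding w_def by (rule integrable_gaussian_weight[OF \<open>\<sigma> > 0\<close>])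
  have w': "integrable lborel (\<lambda>\<xi>. complex_of_real (w \<xi>))"
    using w by simp
  define H where "H = (\<lambda>x \<xi>. (indicator {-R..R} x * f x) * (cis (\<xi> * (a - x)) * complex_of_real (w \<xi>)))"
  have w_meas [measurable]: "w \<in> borel_measurable borel"
    using w by simp
  have normH: "norm (H x \<xi>) = cmod (indicator {-R..R} x * f x) * w \<xi>" for x \<xi>
    by (simp add: H_def norm_mult w_def)
  have int: "integrable (lborel \<Otimes>\<^sub>M lborel) (case_prod H)"
  proof (rule lborel_pair.Fubini_integrable)
    show "case_prod H \<in> borel_measurable (lborel \<Otimes>\<^sub>M lborel)"
      unfolding H_def by measurable
    show "integrable lborel (\<lambda>x. LINT y|lborel. norm (case (x, y) of (x, y) \<Rightarrow> H x y))"
      using integrable_norm[OF integrable_truncation[OF f, of "-R" R]]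
      by (simp add: normH)
    show "AE x in lborel. integrable lborel (\<lambda>y. case (x, y) of (x, y) \<Rightarrow> H x y)"
    proof (rule AE_I2)
      fix x
      have "integrable lborel (\<lambda>y. H x y)"
      proof (rule Bochner_Integration.integrable_bound)
        show "integrable lborel (\<lambda>y. cmod (indicator {-R..R} x * f x) * w y)"
          using w by simp
        show "(\<lambda>y. H x y) \<in> borel_measurable lborel"
          unfolding H_def by measurable
      qed (simp add: normH)
      then show "integrable lborel (\<lambda>y. case (x, y) of (x, y) \<Rightarrow> H x y)"
        by simp
    qed
  qed
  have "(LINT \<xi>|lborel. truncated_fourier R f \<xi> * (cis (\<xi> * a) * complex_of_real (w \<xi>)))
      = (LINT \<xi>|lborel. LINT x|lborel. H x \<xi>)"
  proof (rule Bochner_Integration.integral_cong[OF refl])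
    fix \<xi> :: real
    have "truncated_fourier R f \<xi> * (cis (\<xi> * a) * complex_of_real (w \<xi>))
        = (LINT x|lborel. (indicator {-R..R} x *\<^sub>R (cis (- (\<xi> * x)) * f x)) * (cis (\<xi> * a) * complex_of_real (w \<xi>)))"
      unfolding truncated_fourier_def set_lebesgue_integral_def
      by (rule integral_mult_left_zero[symmetric])
    also have "\<dots> = (LINT x|lborel. H x \<xi>)"
    proof (rule Bochner_Integration.integral_cong[OF refl])
      fix x
      have "cis (- (\<xi> * x)) * cis (\<xi> * a) = cis (\<xi> * (a - x))"
        by (simp add: cis_mult algebra_simps)
      then show "(indicator {-R..R} x *\<^sub>R (cis (- (\<xi> * x)) * f x)) * (cis (\<xi> * a) * complex_of_real (w \<xi>)) = H x \<xi>"
        by (simp add: H_def scaleR_conv_of_real indicator_def mult_ac)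
    qed
    finally show "truncated_fourier R f \<xi> * (cis (\<xi> * a) * complex_of_real (w \<xi>)) = (LINT x|lborel. H x \<xi>)" .
  qed
  also have "\<dots> = (LINT x|lborel. LINT \<xi>|lborel. H x \<xi>)"
    by (rule lborel_pair.Fubini_integral[OF int])
  also have "\<dots> = (LINT x|lborel. (indicator {-R..R} x * f x) * complex_of_real (2 * pi * normal_density 0 \<sigma> (a - x)))"
    unfolding H_def integral_mult_right_zero
    unfolding w_def fourier_gaussian[OF \<open>\<sigma> > 0\<close>] ..
  also have "\<dots> = 2 * pi * (LINT x|lborel. indicator {-R..R} x * f x * complex_of_real (normal_density 0 \<sigma> (a - x)))"
    by (subst integral_mult_right_zero[symmetric])
       (rule Bochner_Integration.integral_cong, auto)
  finally show ?thesis
    by (simp add: w_def)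
qed


lemma square_integrable_normal_density:
  assumes "\<sigma> > 0"
  shows "square_integrable (\<lambda>x. complex_of_real (normal_density 0 \<sigma> (a - x)))"
proof -
  have eq: "normal_density 0 \<sigma> (a - x) = normal_density a \<sigma> x" for x
    by (simp add: normal_density_def power2_commute)
  have "integrable lborel (\<lambda>x. (normal_density a \<sigma> x)\<^sup>2)"
  proof (rule Bochner_Integration.integrable_bound)
    show "integrable lborel (\<lambda>x. 1 / sqrt (2 * pi * \<sigma>\<^sup>2) * normal_density a \<sigma> x)"
      using assms by simp
    have "normal_density a \<sigma> x \<le> 1 / sqrt (2 * pi * \<sigma>\<^sup>2)" for x
      by (simp add: normal_density_def divide_right_mono)
    then have "(normal_density a \<sigma> x)\<^sup>2 \<le> 1 / sqrt (2 * pi * \<sigma>\<^sup>2) * normal_density a \<sigma> x" for x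
      unfolding power2_eq_square by (intro mult_right_mono) simp_all
    then show "AE x in lborel. norm ((normal_density a \<sigma> x)\<^sup>2)
        \<le> norm (1 / sqrt (2 * pi * \<sigma>\<^sup>2) * normal_density a \<sigma> x)"
      by simp
  qed simp
  then show ?thesis
    by (simp add: square_integrable_def eq)
qed

text \<open>Both sides of the identity for truncations pass to the limit: the left one by mean square
convergence, the right one by dominated convergence.\<close>

lemma L2_fourier_gaussian:
  assumes fg: "L2_fourier f g" and "\<sigma> > 0"
  shows "(LINT \<xi>|lborel. g \<xi> * (cis (\<xi> * a) * complex_of_real (exp (- (\<sigma> * \<xi>)\<^sup>2 / 2))))
       = 2 * pi * (LINT x|lborel. f x * complex_of_real (normal_density 0 \<sigma> (a - x)))"
proof -
  define \<phi> where "\<phi> = (\<lambda>\<xi>. cis (\<xi> * a) * complex_of_real (exp (- (\<sigma> * \<xi>)\<^sup>2 / 2)))"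
  define N where "N = (\<lambda>x. complex_of_real (normal_density 0 \<sigma> (a - x)))"
  have f: "square_integrable f" and g: "square_integrable g"
    using fg by (auto simp: L2_fourier_def)
  have [measurable]: "f \<in> borel_measurable borel" "g \<in> borel_measurable borel"
    using f g by (auto intro: square_integrable_measurable)
  have \<phi>: "square_integrable \<phi>"
    unfolding \<phi>_def by (rule square_integrable_gaussian_weight[OF \<open>\<sigma> > 0\<close>])
  have N: "square_integrable N"
    unfolding N_def by (rule square_integrable_normal_density[OF \<open>\<sigma> > 0\<close>])
  have [measurable]: "N \<in> borel_measurable borel" "\<phi> \<in> borel_measurable borel"
    using N \<phi> by (auto intro: square_integrable_measurable)
  have fN: "integrable lborel (\<lambda>x. f x * N x)"
    by (rule integrable_mult_square_integrable[OF f N])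
  have g\<phi>: "integrable lborel (\<lambda>\<xi>. g \<xi> * \<phi> \<xi>)"
    by (rule integrable_mult_square_integrable[OF g \<phi>])
  have F\<phi>: "integrable lborel (\<lambda>\<xi>. truncated_fourier R f \<xi> * \<phi> \<xi>)" for R
  proof (rule Bochner_Integration.integrable_bound)
    let ?B = "LINT x|lborel. cmod (indicator {-R..R} x * f x)"
    show "integrable lborel (\<lambda>\<xi>. ?B * exp (- (\<sigma> * \<xi>)\<^sup>2 / 2))"
      using integrable_gaussian_weight[OF \<open>\<sigma> > 0\<close>] by simp
    show "(\<lambda>\<xi>. truncated_fourier R f \<xi> * \<phi> \<xi>) \<in> borel_measurable lborel"
      using truncated_fourier_measurable[OF f, of R] by simp
    have "norm (truncated_fourier R f \<xi> * \<phi> \<xi>) \<le> ?B * exp (- (\<sigma> * \<xi>)\<^sup>2 / 2)" for \<xi>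
    proof -
      have "norm (truncated_fourier R f \<xi> * \<phi> \<xi>) = cmod (truncated_fourier R f \<xi>) * exp (- (\<sigma> * \<xi>)\<^sup>2 / 2)"
        unfolding \<phi>_def norm_mult norm_cis norm_of_real by simp
      also have "\<dots> \<le> ?B * exp (- (\<sigma> * \<xi>)\<^sup>2 / 2)"
        by (rule mult_right_mono[OF norm_truncated_fourier_le[OF f] exp_ge_zero])
      finally show ?thesis .
    qed
    then show "AE \<xi> in lborel. norm (truncated_fourier R f \<xi> * \<phi> \<xi>) \<le> norm (?B * exp (- (\<sigma> * \<xi>)\<^sup>2 / 2))"
      unfolding real_norm_def by (intro AE_I2 order.trans[OF _ abs_ge_self])
  qed
  have "((\<lambda>R. LINT \<xi>|lborel. (g \<xi> - truncated_fourier R f \<xi>) * \<phi> \<xi>) \<longlongrightarrow> 0) at_top"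
  proof (rule integral_mult_tendsto_of_L2_tendsto[OF _ \<phi>])
    show "(\<lambda>\<xi>. g \<xi> - truncated_fourier R f \<xi>) \<in> borel_measurable lborel" for R
      using truncated_fourier_measurable[OF f, of R] by simp
    show "((\<lambda>R. \<integral>\<^sup>+ \<xi>. ennreal ((cmod (g \<xi> - truncated_fourier R f \<xi>))\<^sup>2) \<partial>lborel) \<longlongrightarrow> 0) at_top"
      using fg unfolding L2_fourier_def truncated_fourier_def by auto
  qed
  also have "(\<lambda>R. LINT \<xi>|lborel. (g \<xi> - truncated_fourier R f \<xi>) * \<phi> \<xi>)
      = (\<lambda>R. (LINT \<xi>|lborel. g \<xi> * \<phi> \<xi>) - 2 * pi * (LINT x|lborel. indicator {-R..R} x * f x * N x))"
    unfolding left_diff_distrib Bochner_Integration.integral_diff[OF g\<phi> F\<phi>]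
    unfolding \<phi>_def N_def truncated_fourier_gaussian[OF f \<open>\<sigma> > 0\<close>] ..
  finally have lim0: "((\<lambda>R. (LINT \<xi>|lborel. g \<xi> * \<phi> \<xi>) - 2 * pi * (LINT x|lborel. indicator {-R..R} x * f x * N x)) \<longlongrightarrow> 0) at_top" .
  have "((\<lambda>R. LINT x|lborel. indicator {-R..R} x * f x * N x) \<longlongrightarrow> (LINT x|lborel. f x * N x)) at_top"
  proof (rule integral_dominated_convergence_at_top[where w = "\<lambda>x. cmod (f x * N x)"])
    show "AE x in lborel. ((\<lambda>R. indicator {-R..R} x * f x * N x) \<longlongrightarrow> f x * N x) at_top"
    proof (rule AE_I2, rule tendsto_eventually)
      fix x :: real
      show "\<forall>\<^sub>F R in at_top. indicator {-R..R} x * f x * N x = f x * N x"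
        using eventually_ge_at_top[of "\<bar>x\<bar>"] by eventually_elim (auto simp: indicator_def)
    qed
    show "integrable lborel (\<lambda>x. cmod (f x * N x))"
      using fN by (rule integrable_norm)
  qed (auto simp: norm_mult indicator_def intro!: always_eventually)
  then have "((\<lambda>R. (LINT \<xi>|lborel. g \<xi> * \<phi> \<xi>) - 2 * pi * (LINT x|lborel. indicator {-R..R} x * f x * N x))
      \<longlongrightarrow> (LINT \<xi>|lborel. g \<xi> * \<phi> \<xi>) - 2 * pi * (LINT x|lborel. f x * N x)) at_top"
    by (intro tendsto_intros)
  from tendsto_unique[OF _ this lim0] show ?thesis
    by (simp add: \<phi>_def N_def)
qed

text \<open>From \<open>u \<le> exp u\<close> with \<open>u = (x - a)\<^sup>2 / (2 \<sigma>\<^sup>2)\<close>. The factor \<open>\<sigma>\<close> makes the density small, uniformly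
away from its centre, as the width shrinks.\<close>

lemma normal_density_le_inverse_square:
  assumes "\<sigma> > 0" "x \<noteq> a"
  shows "normal_density a \<sigma> x \<le> \<sigma> / (x - a)\<^sup>2"
proof -
  define u where "u = (x - a)\<^sup>2 / (2 * \<sigma>\<^sup>2)"
  have u: "u > 0"
    using assms by (simp add: u_def)
  have "u \<le> exp u"
    using exp_ge_add_one_self[of u] by linarith
  then have "exp (- u) \<le> 1 / u"
    using u by (simp add: exp_minus field_simps)
  moreover have "2 \<le> sqrt (2 * pi)"
    using pi_gt3 by (intro real_le_rsqrt) simp
  ultimately have "exp (- u) / (sqrt (2 * pi) * \<sigma>) \<le> (1 / u) / (2 * \<sigma>)"
    using assms u by (intro frac_le mult_right_mono) auto
  also have "\<dots> = \<sigma> / (x - a)\<^sup>2"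
    using assms by (simp add: u_def power2_eq_square[of \<sigma>])
  also have "exp (- u) / (sqrt (2 * pi) * \<sigma>) = normal_density a \<sigma> x"
    using assms by (simp add: normal_density_def u_def real_sqrt_mult)
  finally show ?thesis .
qed

text \<open>Near the centre the oscillation of \<open>f\<close> is small. Away from it \<open>\<bar>f x - f a\<bar>\<close> is split into a part
below \<open>\<bar>f x\<bar>\<^sup>2\<close>, which the smallness of the density controls, and a constant, which Chebyshev's
inequality (the second moment \<open>\<sigma>\<^sup>2\<close>) controls. Splitting this way
allows for unbounded \<open>f\<close>.\<close>

lemma gaussian_average_estimate:
  fixes f :: "real \<Rightarrow> complex"
  assumes f: "square_integrable f" and "\<sigma> > 0" "\<delta> > 0" "\<epsilon> \<ge> 0"
    and near: "\<And>x. \<bar>x - a\<bar> < \<delta> \<Longrightarrow> cmod (f x - f a) \<le> \<epsilon>"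
  shows "cmod ((LINT x|lborel. f x * complex_of_real (normal_density 0 \<sigma> (a - x))) - f a)
     \<le> \<epsilon> + \<sigma> / \<delta>\<^sup>2 * (LINT x|lborel. (cmod (f x))\<^sup>2) + (1 + cmod (f a)) * \<sigma>\<^sup>2 / \<delta>\<^sup>2"
proof -
  let ?N = "normal_density a \<sigma>"
  have N: "normal_density 0 \<sigma> (a - x) = ?N x" for x
    by (simp add: normal_density_def power2_commute)
  have fN: "integrable lborel (\<lambda>x. f x * complex_of_real (?N x))"
    using integrable_mult_square_integrable[OF f square_integrable_normal_density[OF \<open>\<sigma> > 0\<close>, of a]]
    by (simp add: N)
  have N_int: "integrable lborel ?N" and N_eq: "(LINT x|lborel. ?N x) = 1"
    using \<open>\<sigma> > 0\<close> by simp_all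
  have caN: "integrable lborel (\<lambda>x. f a * complex_of_real (?N x))"
    using N_int by simp
  have moment: "has_bochner_integral lborel (\<lambda>x. ?N x * (x - a)\<^sup>2) (\<sigma>\<^sup>2)"
    using normal_moment_even[OF \<open>\<sigma> > 0\<close>, of a 1] by (simp add: numeral_2_eq_2)
  have f2: "integrable lborel (\<lambda>x. (cmod (f x))\<^sup>2)"
    using f by (simp add: square_integrable_def)
  let ?D = "\<lambda>x. \<epsilon> * ?N x + \<sigma> / \<delta>\<^sup>2 * (cmod (f x))\<^sup>2 + (1 + cmod (f a)) / \<delta>\<^sup>2 * (?N x * (x - a)\<^sup>2)"
  have D_int: "has_bochner_integral lborel ?D
      (\<epsilon> * 1 + \<sigma> / \<delta>\<^sup>2 * (LINT x|lborel. (cmod (f x))\<^sup>2) + (1 + cmod (f a)) / \<delta>\<^sup>2 * \<sigma>\<^sup>2)"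
    using has_bochner_integral_integrable[OF N_int] N_eq
    by (intro has_bochner_integral_add has_bochner_integral_mult_right
          has_bochner_integral_integrable[OF f2] moment) simp
  have pointwise: "cmod (f x - f a) * ?N x \<le> ?D x" for x
  proof (cases "\<bar>x - a\<bar> < \<delta>")
    case True
    then have "cmod (f x - f a) * ?N x \<le> \<epsilon> * ?N x"
      by (intro mult_right_mono near) simp_all
    moreover have "0 \<le> \<sigma> / \<delta>\<^sup>2 * (cmod (f x))\<^sup>2" "0 \<le> (1 + cmod (f a)) / \<delta>\<^sup>2 * (?N x * (x - a)\<^sup>2)"
      using assms by simp_all
    ultimately show ?thesis by linarith
  next
    case False
    then have far: "\<delta>\<^sup>2 \<le> (x - a)\<^sup>2" and "x \<noteq> a"
      using \<open>\<delta> > 0\<close> by (auto simp: abs_le_square_iff[symmetric])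
    have "?N x \<le> \<sigma> / (x - a)\<^sup>2"
      by (rule normal_density_le_inverse_square[OF \<open>\<sigma> > 0\<close> \<open>x \<noteq> a\<close>])
    also have "\<dots> \<le> \<sigma> / \<delta>\<^sup>2"
      using far assms by (intro divide_left_mono) (auto intro!: mult_pos_pos simp: \<open>x \<noteq> a\<close>)
    finally have N_le: "?N x \<le> \<sigma> / \<delta>\<^sup>2" .
    have "1 \<le> (x - a)\<^sup>2 / \<delta>\<^sup>2"
      using far \<open>\<delta> > 0\<close> by simp
    then have N_le': "?N x \<le> ?N x * ((x - a)\<^sup>2 / \<delta>\<^sup>2)"
      using mult_left_mono[of 1 "(x - a)\<^sup>2 / \<delta>\<^sup>2" "?N x"] by simp
    have "cmod (f x) \<le> 1 + (cmod (f x))\<^sup>2"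
    proof -
      have "2 * cmod (f x) \<le> 1 + (cmod (f x))\<^sup>2"
        using sum_squares_bound[of 1 "cmod (f x)"] by simp
      then show ?thesis
        using norm_ge_zero[of "f x"] by linarith
    qed
    then have "cmod (f x - f a) \<le> (cmod (f x))\<^sup>2 + (1 + cmod (f a))"
      using norm_triangle_ineq4[of "f x" "f a"] by linarith
    then have "cmod (f x - f a) * ?N x \<le> (cmod (f x))\<^sup>2 * ?N x + (1 + cmod (f a)) * ?N x"
      using mult_right_mono[of _ _ "?N x"] by (fastforce simp flip: distrib_right)
    also have "\<dots> \<le> (cmod (f x))\<^sup>2 * (\<sigma> / \<delta>\<^sup>2) + (1 + cmod (f a)) * (?N x * ((x - a)\<^sup>2 / \<delta>\<^sup>2))"
      by (intro add_mono mult_left_mono N_le N_le') simp_all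
    also have "\<dots> \<le> ?D x"
      using \<open>\<epsilon> \<ge> 0\<close> by (simp add: mult_ac)
    finally show ?thesis .
  qed
  have "(LINT x|lborel. f x * complex_of_real (?N x)) - f a
      = (LINT x|lborel. f x * complex_of_real (?N x)) - (LINT x|lborel. f a * complex_of_real (?N x))"
    using N_eq by simp
  also have "\<dots> = (LINT x|lborel. (f x - f a) * complex_of_real (?N x))"
    unfolding left_diff_distrib by (rule Bochner_Integration.integral_diff[OF fN caN, symmetric])
  finally have "cmod ((LINT x|lborel. f x * complex_of_real (?N x)) - f a)
      = cmod (LINT x|lborel. (f x - f a) * complex_of_real (?N x))"
    by (rule arg_cong)
  also have "\<dots> \<le> (LINT x|lborel. ?D x)"
  proof (rule order.trans[OF integral_norm_bound], rule integral_mono)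
    have "integrable lborel (\<lambda>x. (f x - f a) * complex_of_real (?N x))"
      unfolding left_diff_distrib by (intro Bochner_Integration.integrable_diff fN caN)
    then show "integrable lborel (\<lambda>x. cmod ((f x - f a) * complex_of_real (?N x)))"
      by (rule integrable_norm)
    show "integrable lborel ?D"
      using D_int by (rule integrable.intros)
    show "cmod ((f x - f a) * complex_of_real (?N x)) \<le> ?D x" for x
      using pointwise[of x] by (simp add: norm_mult)
  qed
  also have "(LINT x|lborel. ?D x) = \<epsilon> * 1 + \<sigma> / \<delta>\<^sup>2 * (LINT x|lborel. (cmod (f x))\<^sup>2) + (1 + cmod (f a)) / \<delta>\<^sup>2 * \<sigma>\<^sup>2"
    using D_int by (rule has_bochner_integral_integral_eq)
  finally show ?thesis
    unfolding N by simp
qed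

lemma gaussian_average_tendsto:
  fixes f :: "real \<Rightarrow> complex"
  assumes f: "square_integrable f" and cont: "isCont f a"
  shows "((\<lambda>\<sigma>. LINT x|lborel. f x * complex_of_real (normal_density 0 \<sigma> (a - x))) \<longlongrightarrow> f a) (at_right 0)"
proof (rule tendstoI)
  fix e :: real assume "e > 0"
  obtain \<delta> where "\<delta> > 0" and \<delta>: "\<And>x. \<bar>x - a\<bar> < \<delta> \<Longrightarrow> cmod (f x - f a) < e / 2"
    using cont[unfolded continuous_at_eps_delta] \<open>e > 0\<close>
    by (metis dist_norm half_gt_zero real_norm_def)
  let ?B = "\<lambda>\<sigma>. e / 2 + \<sigma> / \<delta>\<^sup>2 * (LINT x|lborel. (cmod (f x))\<^sup>2) + (1 + cmod (f a)) * \<sigma>\<^sup>2 / \<delta>\<^sup>2"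
  have "(?B \<longlongrightarrow> e / 2 + 0 / \<delta>\<^sup>2 * (LINT x|lborel. (cmod (f x))\<^sup>2) + (1 + cmod (f a)) * 0\<^sup>2 / \<delta>\<^sup>2) (at_right 0)"
    using \<open>\<delta> > 0\<close> by (intro tendsto_intros) auto
  then have "\<forall>\<^sub>F \<sigma> in at_right 0. ?B \<sigma> < e"
    by (rule order_tendstoD(2)) (use \<open>e > 0\<close> in simp)
  moreover have "\<forall>\<^sub>F \<sigma>::real in at_right 0. \<sigma> > 0"
    by (rule eventually_at_right_less)
  ultimately show "\<forall>\<^sub>F \<sigma> in at_right 0. dist (LINT x|lborel. f x * complex_of_real (normal_density 0 \<sigma> (a - x))) (f a) < e"
  proof eventually_elim
    case (elim \<sigma>)
    then show ?case
      using gaussian_average_estimate[OF f \<open>\<sigma> > 0\<close> \<open>\<delta> > 0\<close>, of "e / 2" a] \<delta> \<open>e > 0\<close>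
      by (fastforce simp: dist_norm less_imp_le)
  qed
qed

text \<open>Pairing with modulated Gaussians of shrinking width: the averages of \<open>f\<close> converge to its value at
a point of continuity, and the Gaussian damping of the integrable function \<open>g\<close> disappears in the limit.\<close>

lemma L2_fourier_inversion:
  fixes f :: "real \<Rightarrow> complex"
  assumes fg: "L2_fourier f g" and cont: "isCont f a" and g: "integrable lborel g"
  shows "2 * pi * f a = (LINT \<xi>|lborel. g \<xi> * cis (\<xi> * a))"
proof -
  have f: "square_integrable f"
    using fg by (simp add: L2_fourier_def)
  define \<sigma> where "\<sigma> = (\<lambda>n. 1 / real (Suc n))"
  have \<sigma>_pos: "\<sigma> n > 0" for n
    by (simp add: \<sigma>_def)
  have \<sigma>_lim: "\<sigma> \<longlonglongrightarrow> 0"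
    unfolding \<sigma>_def using LIMSEQ_inverse_real_of_nat by (simp add: inverse_eq_divide)
  then have \<sigma>_right: "filterlim \<sigma> (at_right 0) sequentially"
    using \<sigma>_pos by (auto intro!: tendsto_imp_filterlim_at_right)
  let ?A = "\<lambda>n. LINT x|lborel. f x * complex_of_real (normal_density 0 (\<sigma> n) (a - x))"
  have "(\<lambda>n. 2 * pi * ?A n) \<longlonglongrightarrow> 2 * pi * f a"
    by (intro tendsto_mult tendsto_const filterlim_compose[OF gaussian_average_tendsto[OF f cont] \<sigma>_right])
  moreover have "(\<lambda>n. LINT \<xi>|lborel. g \<xi> * (cis (\<xi> * a) * complex_of_real (exp (- (\<sigma> n * \<xi>)\<^sup>2 / 2))))
      \<longlonglongrightarrow> (LINT \<xi>|lborel. g \<xi> * cis (\<xi> * a))"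
  proof (rule integral_dominated_convergence[where w = "\<lambda>\<xi>. cmod (g \<xi>)"])
    show "AE \<xi> in lborel. (\<lambda>n. g \<xi> * (cis (\<xi> * a) * complex_of_real (exp (- (\<sigma> n * \<xi>)\<^sup>2 / 2)))) \<longlonglongrightarrow> g \<xi> * cis (\<xi> * a)"
    proof (rule AE_I2)
      fix \<xi>
      have "(\<lambda>n. g \<xi> * (cis (\<xi> * a) * complex_of_real (exp (- (\<sigma> n * \<xi>)\<^sup>2 / 2))))
          \<longlonglongrightarrow> g \<xi> * (cis (\<xi> * a) * complex_of_real (exp (- (0 * \<xi>)\<^sup>2 / 2)))"
        by (intro tendsto_intros \<sigma>_lim) simp
      then show "(\<lambda>n. g \<xi> * (cis (\<xi> * a) * complex_of_real (exp (- (\<sigma> n * \<xi>)\<^sup>2 / 2)))) \<longlonglongrightarrow> g \<xi> * cis (\<xi> * a)"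
        by simp
    qed
    show "integrable lborel (\<lambda>\<xi>. cmod (g \<xi>))"
      using g by (rule integrable_norm)
    have [measurable]: "g \<in> borel_measurable borel"
      using g by simp
    show "(\<lambda>\<xi>. g \<xi> * cis (\<xi> * a)) \<in> borel_measurable lborel"
      by measurable
    show "(\<lambda>\<xi>. g \<xi> * (cis (\<xi> * a) * complex_of_real (exp (- (\<sigma> n * \<xi>)\<^sup>2 / 2)))) \<in> borel_measurable lborel" for n
      by measurable
    show "AE \<xi> in lborel. norm (g \<xi> * (cis (\<xi> * a) * complex_of_real (exp (- (\<sigma> n * \<xi>)\<^sup>2 / 2)))) \<le> cmod (g \<xi>)" for n
      by (intro AE_I2) (simp add: norm_mult mult_left_le)
  qed
  ultimately show ?thesis
    unfolding L2_fourier_gaussian[OF fg \<sigma>_pos] by (rule LIMSEQ_unique)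
qed

section \<open>Linearity and uniqueness of the L2 Fourier transform\<close>

lemma cmod_add_square_le: "(cmod (x + y))\<^sup>2 \<le> 2 * (cmod x)\<^sup>2 + 2 * (cmod y)\<^sup>2"
proof -
  have "(cmod (x + y))\<^sup>2 \<le> (cmod x + cmod y)\<^sup>2"
    by (intro power_mono norm_triangle_ineq) simp
  also have "\<dots> \<le> 2 * (cmod x)\<^sup>2 + 2 * (cmod y)\<^sup>2"
    using sum_squares_bound[of "cmod x" "cmod y"] by (simp add: power2_sum)
  finally show ?thesis .
qed

lemma cmod_linear_combination_square_le:
  "(cmod (a * x + b * y))\<^sup>2 \<le> 2 * (cmod a)\<^sup>2 * (cmod x)\<^sup>2 + 2 * (cmod b)\<^sup>2 * (cmod y)\<^sup>2"
  using cmod_add_square_le[of "a * x" "b * y"] by (simp add: norm_mult power_mult_distrib)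

lemma nn_integral_linear_combination_square_le:
  assumes [measurable]: "f \<in> borel_measurable M" "g \<in> borel_measurable M"
  shows "(\<integral>\<^sup>+ x. ennreal ((cmod (a * f x + b * g x))\<^sup>2) \<partial>M)
    \<le> ennreal (2 * (cmod a)\<^sup>2) * (\<integral>\<^sup>+ x. ennreal ((cmod (f x))\<^sup>2) \<partial>M)
     + ennreal (2 * (cmod b)\<^sup>2) * (\<integral>\<^sup>+ x. ennreal ((cmod (g x))\<^sup>2) \<partial>M)"
proof -
  have "(\<integral>\<^sup>+ x. ennreal ((cmod (a * f x + b * g x))\<^sup>2) \<partial>M)
    \<le> (\<integral>\<^sup>+ x. ennreal (2 * (cmod a)\<^sup>2) * ennreal ((cmod (f x))\<^sup>2)
           + ennreal (2 * (cmod b)\<^sup>2) * ennreal ((cmod (g x))\<^sup>2) \<partial>M)"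
    by (intro nn_integral_mono)
       (simp add: ennreal_mult[symmetric] ennreal_plus[symmetric] cmod_linear_combination_square_le del: ennreal_plus)
  then show ?thesis
    by (simp add: nn_integral_add nn_integral_cmult)
qed

lemma square_integrable_linear_combination:
  assumes f: "square_integrable f" and g: "square_integrable g"
  shows "square_integrable (\<lambda>x. a * f x + b * g x)"
proof -
  have [measurable]: "f \<in> borel_measurable borel" "g \<in> borel_measurable borel"
    using f g by (auto intro: square_integrable_measurable)
  have "integrable lborel (\<lambda>x. (cmod (a * f x + b * g x))\<^sup>2)"
  proof (rule Bochner_Integration.integrable_bound)
    show "integrable lborel (\<lambda>x. 2 * (cmod a)\<^sup>2 * (cmod (f x))\<^sup>2 + 2 * (cmod b)\<^sup>2 * (cmod (g x))\<^sup>2)"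
      using f g by (simp add: square_integrable_def)
    show "AE x in lborel. norm ((cmod (a * f x + b * g x))\<^sup>2)
        \<le> norm (2 * (cmod a)\<^sup>2 * (cmod (f x))\<^sup>2 + 2 * (cmod b)\<^sup>2 * (cmod (g x))\<^sup>2)"
      using cmod_linear_combination_square_le by (intro AE_I2) simp
  qed measurable
  then show ?thesis
    by (simp add: square_integrable_def)
qed

lemma L2_fourier_iff:
  "L2_fourier f g \<longleftrightarrow> square_integrable f \<and> square_integrable g \<and>
     ((\<lambda>R. \<integral>\<^sup>+ \<xi>. ennreal ((cmod (g \<xi> - truncated_fourier R f \<xi>))\<^sup>2) \<partial>lborel) \<longlongrightarrow> 0) at_top"
  by (simp add: L2_fourier_def truncated_fourier_def)

lemma truncated_fourier_linear_combination:
  assumes f: "square_integrable f" and g: "square_integrable g"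
  shows "truncated_fourier R (\<lambda>x. a * f x + b * g x) \<xi>
       = a * truncated_fourier R f \<xi> + b * truncated_fourier R g \<xi>"
proof -
  have int: "set_integrable lborel {-R..R} (\<lambda>x. cis (- (\<xi> * x)) * h x)" if h: "square_integrable h" for h
    unfolding set_integrable_def
  proof (rule Bochner_Integration.integrable_bound[OF integrable_truncation[OF h, of "-R" R]])
    have [measurable]: "h \<in> borel_measurable borel"
      using h by (rule square_integrable_measurable)
    show "(\<lambda>x. indicator {-R..R} x *\<^sub>R (cis (- (\<xi> * x)) * h x)) \<in> borel_measurable lborel"
      by measurable
  qed (auto simp: norm_mult indicator_def)
  have "truncated_fourier R (\<lambda>x. a * f x + b * g x) \<xi>
      = (LINT x:{-R..R}|lborel. a * (cis (- (\<xi> * x)) * f x) + b * (cis (- (\<xi> * x)) * g x))"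
    unfolding truncated_fourier_def by (simp add: algebra_simps)
  also have "\<dots> = a * truncated_fourier R f \<xi> + b * truncated_fourier R g \<xi>"
    unfolding truncated_fourier_def
    using int[OF f] int[OF g] by (subst set_integral_add) auto
  finally show ?thesis .
qed

lemma L2_fourier_linear_combination:
  assumes 1: "L2_fourier f1 g1" and 2: "L2_fourier f2 g2"
  shows "L2_fourier (\<lambda>x. a * f1 x + b * f2 x) (\<lambda>\<xi>. a * g1 \<xi> + b * g2 \<xi>)"
proof -
  have sq: "square_integrable f1" "square_integrable g1" "square_integrable f2" "square_integrable g2"
    using 1 2 by (auto simp: L2_fourier_iff)
  have [measurable]: "g1 \<in> borel_measurable borel" "g2 \<in> borel_measurable borel"
    using sq by (auto intro: square_integrable_measurable)
  have [measurable]: "truncated_fourier R f1 \<in> borel_measurable borel" "truncated_fourier R f2 \<in> borel_measurable borel" for R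
    using sq by (auto intro: truncated_fourier_measurable)
  let ?I1 = "\<lambda>R. \<integral>\<^sup>+ \<xi>. ennreal ((cmod (g1 \<xi> - truncated_fourier R f1 \<xi>))\<^sup>2) \<partial>lborel"
  let ?I2 = "\<lambda>R. \<integral>\<^sup>+ \<xi>. ennreal ((cmod (g2 \<xi> - truncated_fourier R f2 \<xi>))\<^sup>2) \<partial>lborel"
  let ?I = "\<lambda>R. \<integral>\<^sup>+ \<xi>. ennreal ((cmod (a * g1 \<xi> + b * g2 \<xi>
        - truncated_fourier R (\<lambda>x. a * f1 x + b * f2 x) \<xi>))\<^sup>2) \<partial>lborel"
  let ?B = "\<lambda>R. ennreal (2 * (cmod a)\<^sup>2) * ?I1 R + ennreal (2 * (cmod b)\<^sup>2) * ?I2 R"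
  have "?I R \<le> ?B R" for R
  proof -
    have "a * g1 \<xi> + b * g2 \<xi> - truncated_fourier R (\<lambda>x. a * f1 x + b * f2 x) \<xi>
        = a * (g1 \<xi> - truncated_fourier R f1 \<xi>) + b * (g2 \<xi> - truncated_fourier R f2 \<xi>)" for \<xi>
      by (simp add: truncated_fourier_linear_combination[OF sq(1,3)] algebra_simps)
    then show ?thesis
      using nn_integral_linear_combination_square_le
        [of "\<lambda>\<xi>. g1 \<xi> - truncated_fourier R f1 \<xi>" lborel "\<lambda>\<xi>. g2 \<xi> - truncated_fourier R f2 \<xi>" a b]
      by simp
  qed
  moreover have "(?B \<longlongrightarrow> ennreal (2 * (cmod a)\<^sup>2) * 0 + ennreal (2 * (cmod b)\<^sup>2) * 0) at_top"
    using 1 2 by (intro tendsto_add ennreal_tendsto_cmult) (auto simp: L2_fourier_iff)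
  ultimately have "(?I \<longlongrightarrow> 0) at_top"
    by (intro tendsto_sandwich[where f = "\<lambda>_. 0" and g = ?I and h = ?B]) auto
  then show ?thesis
    using sq by (simp add: L2_fourier_iff square_integrable_linear_combination)
qed

text \<open>By linearity the difference is a transform of zero, all of whose truncated transforms vanish.\<close>

lemma L2_fourier_unique:
  assumes 1: "L2_fourier f g1" and 2: "L2_fourier f g2"
  shows "AE \<xi> in lborel. g1 \<xi> = g2 \<xi>"
proof -
  define g where "g = (\<lambda>\<xi>. 1 * g1 \<xi> + (- 1) * g2 \<xi>)"
  have "L2_fourier (\<lambda>x. 1 * f x + (- 1) * f x) g"
    unfolding g_def by (rule L2_fourier_linear_combination[OF 1 2])
  then have zero: "L2_fourier (\<lambda>x. 0) g"
    by simp
  then have [measurable]: "g \<in> borel_measurable borel"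
    by (auto simp: L2_fourier_iff intro: square_integrable_measurable)
  have "truncated_fourier R (\<lambda>x. 0) \<xi> = 0" for R \<xi>
    by (simp add: truncated_fourier_def)
  with zero have "((\<lambda>R::real. \<integral>\<^sup>+ \<xi>. ennreal ((cmod (g \<xi>))\<^sup>2) \<partial>lborel) \<longlongrightarrow> 0) at_top"
    by (simp add: L2_fourier_iff)
  then have "(\<integral>\<^sup>+ \<xi>. ennreal ((cmod (g \<xi>))\<^sup>2) \<partial>lborel) = 0"
    by (simp add: tendsto_const_iff)
  then have "AE \<xi> in lborel. g \<xi> = 0"
    by (simp add: nn_integral_0_iff_AE)
  then show ?thesis
    by eventually_elim (simp add: g_def)
qed

lemma L2_fourier_cong_AE:
  assumes fg: "L2_fourier f g" and ae: "AE x in lborel. f x = f' x" and [measurable]: "f' \<in> borel_measurable borel"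
  shows "L2_fourier f' g"
proof -
  have [measurable]: "f \<in> borel_measurable borel"
    using fg by (auto simp: L2_fourier_iff intro: square_integrable_measurable)
  have "truncated_fourier R f' \<xi> = truncated_fourier R f \<xi>" for R \<xi>
    unfolding truncated_fourier_def set_lebesgue_integral_def
    by (rule integral_cong_AE) (measurable, use ae in \<open>eventually_elim, simp\<close>)
  moreover have "integrable lborel (\<lambda>x. (cmod (f' x))\<^sup>2) \<longleftrightarrow> integrable lborel (\<lambda>x. (cmod (f x))\<^sup>2)"
    by (rule integrable_cong_AE) (measurable, use ae in \<open>eventually_elim, simp\<close>)
  ultimately show ?thesis
    using fg by (simp add: L2_fourier_iff square_integrable_def)
qed

section \<open>Sobolev embedding\<close>

text \<open>The weight is at most 1 on \<open>[-1, 1]\<close> and at most \<open>\<bar>\<xi>\<bar> powr (- 2 * s)\<close> outside, where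
\<open>2 * s > 1\<close>.\<close>

lemma integrable_sobolev_weight:
  fixes s :: real
  assumes "s > 1 / 2"
  shows "integrable lborel (\<lambda>\<xi>. (1 + \<xi>\<^sup>2) powr (- s))"
proof -
  define h where "h = (\<lambda>\<xi>::real. indicator {1..} \<xi> * \<xi> powr (- 2 * s))"
  have [measurable]: "h \<in> borel_measurable borel"
    unfolding h_def by measurable
  have h: "integrable lborel h"
  proof -
    have "((\<lambda>\<xi>. \<xi> powr (- 2 * s)) has_integral -(1 powr (- 2 * s + 1)) / (- 2 * s + 1)) {1..}"
      using assms by (intro has_integral_powr_to_inf) auto
    then have "(\<lambda>\<xi>. \<xi> powr (- 2 * s)) absolutely_integrable_on {1..}"
      by (intro nonnegative_absolutely_integrable_1) (auto simp: integrable_on_def)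
    then have "integrable lebesgue h"
      by (simp add: set_integrable_def h_def)
    then show ?thesis
      by (simp add: integrable_completion)
  qed
  then have h': "integrable lborel (\<lambda>\<xi>. h (- \<xi>))"
    using lborel_integrable_real_affine[of h "-1" 0] by simp
  show ?thesis
  proof (rule Bochner_Integration.integrable_bound)
    show "integrable lborel (\<lambda>\<xi>. indicator {-1..1} \<xi> + h \<xi> + h (- \<xi>))"
      using h h' by (auto simp: integrable_indicator_iff)
    show "(\<lambda>\<xi>. (1 + \<xi>\<^sup>2) powr (- s)) \<in> borel_measurable lborel"
      by measurable
    have "(1 + \<xi>\<^sup>2) powr (- s) \<le> indicator {-1..1} \<xi> + h \<xi> + h (- \<xi>)" for \<xi> :: real
    proof (cases "\<bar>\<xi>\<bar> \<le> 1")
      case True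
      have "(1 + \<xi>\<^sup>2) powr (- s) \<le> (1 + \<xi>\<^sup>2) powr 0"
        using assms by (intro powr_mono) auto
      also have "\<dots> = 1"
        by (simp add: add_nonneg_eq_0_iff)
      finally have "(1 + \<xi>\<^sup>2) powr (- s) \<le> 1" .
      moreover have "h \<xi> \<ge> 0" "h (- \<xi>) \<ge> 0"
        by (simp_all add: h_def)
      moreover have "indicator {-1..1} \<xi> = (1 :: real)"
        using True by (auto simp: indicator_def)
      ultimately show ?thesis
        by linarith
    next
      case False
      have "(1 + \<xi>\<^sup>2) powr (- s) \<le> (\<bar>\<xi>\<bar> powr 2) powr (- s)"
        using False assms by (intro powr_mono2') auto
      also have "\<dots> = \<bar>\<xi>\<bar> powr (- 2 * s)"
        by (subst powr_powr) simp
      also have "\<dots> = h \<xi> + h (- \<xi>)"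
        using False by (auto simp: h_def indicator_def abs_if)
      finally show ?thesis
        by (simp add: indicator_def)
    qed
    then show "AE \<xi> in lborel. norm ((1 + \<xi>\<^sup>2) powr (- s)) \<le> norm (indicator {-1..1} \<xi> + h \<xi> + h (- \<xi>))"
      by (intro AE_I2) (simp, meson abs_ge_self order.trans)
  qed
qed

lemma Cauchy_Schwarz_integral:
  fixes f g :: "'a \<Rightarrow> real"
  assumes [measurable]: "f \<in> borel_measurable M" "g \<in> borel_measurable M"
    and f2: "integrable M (\<lambda>x. (f x)\<^sup>2)" and g2: "integrable M (\<lambda>x. (g x)\<^sup>2)"
  shows "integrable M (\<lambda>x. f x * g x)"
    and "(LINT x|M. \<bar>f x * g x\<bar>) \<le> sqrt (LINT x|M. (f x)\<^sup>2) * sqrt (LINT x|M. (g x)\<^sup>2)"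
proof -
  define A where "A = (LINT x|M. (f x)\<^sup>2)"
  define B where "B = (LINT x|M. (g x)\<^sup>2)"
  have AB: "A \<ge> 0" "B \<ge> 0"
    unfolding A_def B_def by (auto intro: integral_nonneg)
  have "(\<integral>\<^sup>+ x. ennreal \<bar>f x * g x\<bar> \<partial>M)\<^sup>2 = (\<integral>\<^sup>+ x. ennreal \<bar>f x\<bar> * ennreal \<bar>g x\<bar> \<partial>M)\<^sup>2"
    by (simp add: abs_mult ennreal_mult)
  also have "\<dots> \<le> (\<integral>\<^sup>+ x. (ennreal \<bar>f x\<bar>)\<^sup>2 \<partial>M) * (\<integral>\<^sup>+ x. (ennreal \<bar>g x\<bar>)\<^sup>2 \<partial>M)"
    by (rule Cauchy_Schwarz_nn_integral) measurable
  also have "(\<integral>\<^sup>+ x. (ennreal \<bar>f x\<bar>)\<^sup>2 \<partial>M) = ennreal A"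
    using nn_integral_eq_integral[OF f2] by (simp add: A_def ennreal_power)
  also have "(\<integral>\<^sup>+ x. (ennreal \<bar>g x\<bar>)\<^sup>2 \<partial>M) = ennreal B"
    using nn_integral_eq_integral[OF g2] by (simp add: B_def ennreal_power)
  also have "ennreal A * ennreal B = (ennreal (sqrt A * sqrt B))\<^sup>2"
    using AB by (simp add: ennreal_power ennreal_mult power_mult_distrib)
  finally have sq_le: "(\<integral>\<^sup>+ x. ennreal \<bar>f x * g x\<bar> \<partial>M)\<^sup>2 \<le> (ennreal (sqrt A * sqrt B))\<^sup>2" .
  then have le: "(\<integral>\<^sup>+ x. ennreal \<bar>f x * g x\<bar> \<partial>M) \<le> ennreal (sqrt A * sqrt B)"
  proof (cases "\<integral>\<^sup>+ x. ennreal \<bar>f x * g x\<bar> \<partial>M")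
    case (real r)
    have AB': "0 \<le> sqrt A * sqrt B"
      using AB by simp
    have "ennreal (r\<^sup>2) \<le> ennreal ((sqrt A * sqrt B)\<^sup>2)"
      using sq_le unfolding real(2) ennreal_power[OF real(1)] ennreal_power[OF AB'] .
    then have "r\<^sup>2 \<le> (sqrt A * sqrt B)\<^sup>2"
      by (simp only: ennreal_le_iff[OF zero_le_power2])
    then have "r \<le> sqrt A * sqrt B"
      using AB' by (rule power2_le_imp_le)
    then show ?thesis
      unfolding real(2) by (rule ennreal_leI)
  next
    case top
    have "(ennreal (sqrt A * sqrt B))\<^sup>2 < \<top>"
      by (simp add: power2_eq_square ennreal_mult_less_top)
    with sq_le show ?thesis
      unfolding top by (simp add: power2_eq_square top_unique)
  qed
  then have "(\<integral>\<^sup>+ x. ennreal (norm (f x * g x)) \<partial>M) < \<infinity>"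
    using le_less_trans[OF le] by simp
  then show int: "integrable M (\<lambda>x. f x * g x)"
    by (simp add: integrable_iff_bounded)
  have "ennreal (LINT x|M. \<bar>f x * g x\<bar>) \<le> ennreal (sqrt A * sqrt B)"
    using le nn_integral_eq_integral[OF integrable_abs[OF int]] by simp
  then show "(LINT x|M. \<bar>f x * g x\<bar>) \<le> sqrt (LINT x|M. (f x)\<^sup>2) * sqrt (LINT x|M. (g x)\<^sup>2)"
    using AB by (simp add: A_def B_def ennreal_le_iff)
qed

text \<open>The norm is defined with a chosen transform; uniqueness almost everywhere shows that the choice
inherits the integrability of any other transform.\<close>

lemma sobolev_fourier:
  assumes "f \<in> sobolev s"
  obtains g where "L2_fourier (\<lambda>x. complex_of_real (f x)) g"
    and "integrable lborel (\<lambda>\<xi>. (1 + \<xi>\<^sup>2) powr s * (cmod (g \<xi>))\<^sup>2)"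
    and "sobolev_norm s f = sqrt (LINT \<xi>|lborel. (1 + \<xi>\<^sup>2) powr s * (cmod (g \<xi>))\<^sup>2)"
proof -
  obtain g0 where g0: "L2_fourier (\<lambda>x. complex_of_real (f x)) g0"
    and int0: "integrable lborel (\<lambda>\<xi>. (1 + \<xi>\<^sup>2) powr s * (cmod (g0 \<xi>))\<^sup>2)"
    using assms by (auto simp: sobolev_def)
  define g where "g = (SOME g. L2_fourier (\<lambda>x. complex_of_real (f x)) g)"
  have g: "L2_fourier (\<lambda>x. complex_of_real (f x)) g"
    unfolding g_def by (rule someI[of "L2_fourier (\<lambda>x. complex_of_real (f x))", OF g0])
  have [measurable]: "g \<in> borel_measurable borel" "g0 \<in> borel_measurable borel"
    using g g0 by (auto simp: L2_fourier_iff intro: square_integrable_measurable)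
  have "integrable lborel (\<lambda>\<xi>. (1 + \<xi>\<^sup>2) powr s * (cmod (g \<xi>))\<^sup>2)
      \<longleftrightarrow> integrable lborel (\<lambda>\<xi>. (1 + \<xi>\<^sup>2) powr s * (cmod (g0 \<xi>))\<^sup>2)"
    by (rule integrable_cong_AE) (measurable, use L2_fourier_unique[OF g g0] in \<open>eventually_elim, simp\<close>)
  with int0 have "integrable lborel (\<lambda>\<xi>. (1 + \<xi>\<^sup>2) powr s * (cmod (g \<xi>))\<^sup>2)"
    by simp
  moreover have "sobolev_norm s f = sqrt (LINT \<xi>|lborel. (1 + \<xi>\<^sup>2) powr s * (cmod (g \<xi>))\<^sup>2)"
    by (simp add: sobolev_norm_def g_def)
  ultimately show ?thesis
    using g that by blast
qed

lemma sobolev_linear_combination: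
  assumes f: "f \<in> sobolev s" and h: "h \<in> sobolev s"
  shows "(\<lambda>x. a * f x + b * h x) \<in> sobolev s"
proof -
  obtain f' where f': "L2_fourier (\<lambda>x. complex_of_real (f x)) f'"
    and intf: "integrable lborel (\<lambda>\<xi>. (1 + \<xi>\<^sup>2) powr s * (cmod (f' \<xi>))\<^sup>2)"
    using f by (auto simp: sobolev_def)
  obtain h' where h': "L2_fourier (\<lambda>x. complex_of_real (h x)) h'"
    and inth: "integrable lborel (\<lambda>\<xi>. (1 + \<xi>\<^sup>2) powr s * (cmod (h' \<xi>))\<^sup>2)"
    using h by (auto simp: sobolev_def)
  let ?g = "\<lambda>\<xi>. complex_of_real a * f' \<xi> + complex_of_real b * h' \<xi>"
  have [measurable]: "f' \<in> borel_measurable borel" "h' \<in> borel_measurable borel"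
    using f' h' by (auto simp: L2_fourier_iff intro: square_integrable_measurable)
  have "L2_fourier (\<lambda>x. complex_of_real (a * f x + b * h x)) ?g"
    using L2_fourier_linear_combination[OF f' h', of "complex_of_real a" "complex_of_real b"] by simp
  moreover have "integrable lborel (\<lambda>\<xi>. (1 + \<xi>\<^sup>2) powr s * (cmod (?g \<xi>))\<^sup>2)"
  proof (rule Bochner_Integration.integrable_bound)
    let ?B = "\<lambda>\<xi>. 2 * a\<^sup>2 * ((1 + \<xi>\<^sup>2) powr s * (cmod (f' \<xi>))\<^sup>2) + 2 * b\<^sup>2 * ((1 + \<xi>\<^sup>2) powr s * (cmod (h' \<xi>))\<^sup>2)"
    show "integrable lborel ?B"
      by (intro Bochner_Integration.integrable_add integrable_mult_right intf inth)
    show "(\<lambda>\<xi>. (1 + \<xi>\<^sup>2) powr s * (cmod (?g \<xi>))\<^sup>2) \<in> borel_measurable lborel"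
      by measurable
    have "(1 + \<xi>\<^sup>2) powr s * (cmod (?g \<xi>))\<^sup>2 \<le> ?B \<xi>" for \<xi>
    proof -
      have "(1 + \<xi>\<^sup>2) powr s * (cmod (?g \<xi>))\<^sup>2
          \<le> (1 + \<xi>\<^sup>2) powr s * (2 * a\<^sup>2 * (cmod (f' \<xi>))\<^sup>2 + 2 * b\<^sup>2 * (cmod (h' \<xi>))\<^sup>2)"
        using cmod_linear_combination_square_le[of "complex_of_real a" "f' \<xi>" "complex_of_real b" "h' \<xi>"]
        by (intro mult_left_mono) simp_all
      then show ?thesis
        by (simp add: algebra_simps)
    qed
    then show "AE \<xi> in lborel. norm ((1 + \<xi>\<^sup>2) powr s * (cmod (?g \<xi>))\<^sup>2) \<le> norm (?B \<xi>)"
      by (intro AE_I2) simp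
  qed
  ultimately show ?thesis
    unfolding sobolev_def by blast
qed

text \<open>The constant of the embedding of \<open>H\<^sup>s\<close> into the bounded functions, for \<open>s > 1/2\<close>; a factor
\<open>1 / (2 \<pi>)\<close> is given away.\<close>

definition sobolev_constant :: "real \<Rightarrow> real" where
  "sobolev_constant s = sqrt (LINT \<xi>|lborel. (1 + \<xi>\<^sup>2) powr (- s))"

text \<open>The Cauchy-Schwarz inequality for the factors \<open>(1 + \<xi>\<^sup>2) powr (- (s - r) / 2)\<close> and
\<open>(1 + \<xi>\<^sup>2) powr (s / 2) * cmod (g \<xi>)\<close>. The exponent \<open>r\<close> counts derivatives: \<open>r = 0\<close> bounds
a function, \<open>r = 1\<close> its Lipschitz constant.\<close>

lemma sobolev_weighted_L1:
  assumes g [measurable]: "g \<in> borel_measurable borel"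
    and int: "integrable lborel (\<lambda>\<xi>. (1 + \<xi>\<^sup>2) powr s * (cmod (g \<xi>))\<^sup>2)"
    and "s - r > 1 / 2"
  shows "integrable lborel (\<lambda>\<xi>. (1 + \<xi>\<^sup>2) powr (r / 2) * cmod (g \<xi>))"
    and "(LINT \<xi>|lborel. (1 + \<xi>\<^sup>2) powr (r / 2) * cmod (g \<xi>))
       \<le> sobolev_constant (s - r) * sqrt (LINT \<xi>|lborel. (1 + \<xi>\<^sup>2) powr s * (cmod (g \<xi>))\<^sup>2)"
proof -
  have pos: "1 + \<xi>\<^sup>2 > 0" for \<xi> :: real
    by (simp add: add_pos_nonneg)
  define u where "u = (\<lambda>\<xi>::real. (1 + \<xi>\<^sup>2) powr (- (s - r) / 2))"
  define w where "w = (\<lambda>\<xi>::real. (1 + \<xi>\<^sup>2) powr (s / 2) * cmod (g \<xi>))"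
  have [measurable]: "u \<in> borel_measurable lborel" "w \<in> borel_measurable lborel"
    unfolding u_def w_def by measurable
  have u2: "(u \<xi>)\<^sup>2 = (1 + \<xi>\<^sup>2) powr (- (s - r))" for \<xi>
    by (simp add: u_def power2_eq_square flip: powr_add)
  have w2: "(w \<xi>)\<^sup>2 = (1 + \<xi>\<^sup>2) powr s * (cmod (g \<xi>))\<^sup>2" for \<xi>
  proof -
    have "((1 + \<xi>\<^sup>2) powr (s / 2))\<^sup>2 = (1 + \<xi>\<^sup>2) powr s"
      by (simp add: power2_eq_square flip: powr_add)
    then show ?thesis
      by (simp add: w_def power_mult_distrib)
  qed
  have uw: "u \<xi> * w \<xi> = (1 + \<xi>\<^sup>2) powr (r / 2) * cmod (g \<xi>)" for \<xi>
  proof -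
    have "(1 + \<xi>\<^sup>2) powr (- (s - r) / 2) * (1 + \<xi>\<^sup>2) powr (s / 2) = (1 + \<xi>\<^sup>2) powr (- (s - r) / 2 + s / 2)"
      by (rule powr_add[symmetric])
    also have "- (s - r) / 2 + s / 2 = r / 2"
      by (simp add: field_simps)
    finally show ?thesis
      by (simp add: u_def w_def)
  qed
  have int_u: "integrable lborel (\<lambda>\<xi>. (u \<xi>)\<^sup>2)" and int_w: "integrable lborel (\<lambda>\<xi>. (w \<xi>)\<^sup>2)"
    unfolding u2 w2 by (fact integrable_sobolev_weight[OF \<open>s - r > 1 / 2\<close>], fact int)
  show "integrable lborel (\<lambda>\<xi>. (1 + \<xi>\<^sup>2) powr (r / 2) * cmod (g \<xi>))"
    using Cauchy_Schwarz_integral(1)[OF _ _ int_u int_w] by (simp add: uw)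
  show "(LINT \<xi>|lborel. (1 + \<xi>\<^sup>2) powr (r / 2) * cmod (g \<xi>))
       \<le> sobolev_constant (s - r) * sqrt (LINT \<xi>|lborel. (1 + \<xi>\<^sup>2) powr s * (cmod (g \<xi>))\<^sup>2)"
    using Cauchy_Schwarz_integral(2)[OF _ _ int_u int_w]
    by (simp add: uw u2 w2 sobolev_constant_def abs_mult)
qed

text \<open>Elements of a Sobolev space are determined only almost everywhere, as is the time derivative of a
strong solution; the bound is therefore stated for a continuous representative.\<close>

lemma sobolev_bound:
  assumes f: "f \<in> sobolev s" and "s > 1 / 2"
    and ae: "AE x in lborel. f x = h x" and h: "continuous_on UNIV h"
  shows "\<bar>h x\<bar> \<le> sobolev_constant s * sobolev_norm s f"
proof -
  obtain g where g: "L2_fourier (\<lambda>x. complex_of_real (f x)) g"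
    and int: "integrable lborel (\<lambda>\<xi>. (1 + \<xi>\<^sup>2) powr s * (cmod (g \<xi>))\<^sup>2)"
    and norm: "sobolev_norm s f = sqrt (LINT \<xi>|lborel. (1 + \<xi>\<^sup>2) powr s * (cmod (g \<xi>))\<^sup>2)"
    using sobolev_fourier[OF f] .
  have g_meas: "g \<in> borel_measurable borel"
    using g by (auto simp: L2_fourier_iff intro: square_integrable_measurable)
  have [measurable]: "h \<in> borel_measurable borel"
    using h by (rule borel_measurable_continuous_onI)
  have "AE x in lborel. complex_of_real (f x) = complex_of_real (h x)"
    using ae by eventually_elim simp
  then have hg: "L2_fourier (\<lambda>x. complex_of_real (h x)) g"
    by (rule L2_fourier_cong_AE[OF g]) measurable
  have one: "(1 + \<xi>\<^sup>2) powr (0 / 2) = (1::real)" for \<xi> :: real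
    by (simp add: add_nonneg_eq_0_iff)
  note L1 = sobolev_weighted_L1[OF g_meas int, of 0, unfolded one]
  have "integrable lborel (\<lambda>\<xi>. cmod (g \<xi>))"
    using L1(1) \<open>s > 1 / 2\<close> by simp
  then have "integrable lborel g"
    using g_meas by (simp add: integrable_norm_iff)
  moreover have "isCont (\<lambda>x. complex_of_real (h x)) x"
    using h by (intro continuous_intros) (simp add: continuous_on_eq_continuous_at)
  ultimately have "2 * pi * complex_of_real (h x) = (LINT \<xi>|lborel. g \<xi> * cis (\<xi> * x))"
    by (intro L2_fourier_inversion[OF hg])
  then have "cmod (complex_of_real (2 * pi) * complex_of_real (h x)) \<le> (LINT \<xi>|lborel. cmod (g \<xi>))"
    using integral_norm_bound[of lborel "\<lambda>\<xi>. g \<xi> * cis (\<xi> * x)"] by (simp add: norm_mult)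
  then have "2 * pi * \<bar>h x\<bar> \<le> sobolev_constant s * sobolev_norm s f"
    using L1(2) \<open>s > 1 / 2\<close> by (simp add: norm norm_mult)
  moreover have "1 * \<bar>h x\<bar> \<le> 2 * pi * \<bar>h x\<bar>"
    using pi_gt3 by (intro mult_right_mono) auto
  ultimately show ?thesis
    by simp
qed

lemma norm_cis_diff_le: "cmod (cis a - cis b) \<le> \<bar>a - b\<bar>"
proof -
  have "cis a - cis b = cis b * (cis (a - b) - 1)"
    by (simp add: cis_mult right_diff_distrib)
  then have "cmod (cis a - cis b) = cmod (cis (a - b) - 1)"
    by (simp add: norm_mult)
  also have "\<dots> \<le> \<bar>a - b\<bar>"
    using iexp_approx1[of "a - b" 0] by (simp add: cis_conv_exp)
  finally show ?thesis .
qed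

text \<open>The inversion formula at two points shows that \<open>f\<close> is Lipschitz with the constant on the right, by
\<open>\<bar>exp (i a) - exp (i b)\<bar> \<le> \<bar>a - b\<bar>\<close>. This bounds the derivative without
differentiating under the integral.\<close>

lemma sobolev_deriv_bound:
  assumes f: "f \<in> sobolev s" and "s > 3 / 2" and diff: "\<And>x. f differentiable at x"
  shows "\<bar>deriv f x\<bar> \<le> sobolev_constant (s - 1) * sobolev_norm s f"
proof -
  obtain g where g: "L2_fourier (\<lambda>x. complex_of_real (f x)) g"
    and int: "integrable lborel (\<lambda>\<xi>. (1 + \<xi>\<^sup>2) powr s * (cmod (g \<xi>))\<^sup>2)"
    and norm: "sobolev_norm s f = sqrt (LINT \<xi>|lborel. (1 + \<xi>\<^sup>2) powr s * (cmod (g \<xi>))\<^sup>2)"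
    using sobolev_fourier[OF f] .
  have [measurable]: "g \<in> borel_measurable borel"
    using g by (auto simp: L2_fourier_iff intro: square_integrable_measurable)
  define C where "C = sobolev_constant (s - 1) * sobolev_norm s f"
  note L1 = sobolev_weighted_L1[OF _ int, of 1]
  define w where "w = (\<lambda>\<xi>. (1 + \<xi>\<^sup>2) powr (1 / 2) * cmod (g \<xi>))"
  have w: "integrable lborel w" and w_le: "(LINT \<xi>|lborel. w \<xi>) \<le> C"
    using L1 \<open>s > 3 / 2\<close> by (simp_all add: w_def C_def norm)
  have root_ge: "1 \<le> (1 + \<xi>\<^sup>2) powr (1 / 2)" "\<bar>\<xi>\<bar> \<le> (1 + \<xi>\<^sup>2) powr (1 / 2)" for \<xi> :: real
    by (auto simp: powr_half_sqrt intro!: real_le_rsqrt)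
  have "integrable lborel g"
  proof (rule Bochner_Integration.integrable_bound[OF w])
    show "AE \<xi> in lborel. norm (g \<xi>) \<le> norm (w \<xi>)"
      using mult_right_mono[OF root_ge(1) norm_ge_zero] by (intro AE_I2) (simp add: w_def)
  qed simp
  then have int_cis: "integrable lborel (\<lambda>\<xi>. g \<xi> * cis (\<xi> * y))" for y
    by (rule Bochner_Integration.integrable_bound) (auto simp: norm_mult)
  have isCont: "isCont (\<lambda>x. complex_of_real (f x)) y" for y
    using diff[of y] by (intro continuous_intros differentiable_imp_continuous_within)
  have inversion: "2 * pi * complex_of_real (f y) = (LINT \<xi>|lborel. g \<xi> * cis (\<xi> * y))" for y
    by (rule L2_fourier_inversion[OF g isCont \<open>integrable lborel g\<close>])
  have lipschitz: "\<bar>f y - f z\<bar> \<le> C * \<bar>y - z\<bar>" for y z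
  proof -
    have "complex_of_real (2 * pi) * complex_of_real (f y - f z) = (LINT \<xi>|lborel. g \<xi> * cis (\<xi> * y) - g \<xi> * cis (\<xi> * z))"
      using inversion[of y] inversion[of z]
      by (simp add: Bochner_Integration.integral_diff[OF int_cis int_cis] algebra_simps)
    then have "cmod (complex_of_real (2 * pi) * complex_of_real (f y - f z))
        = cmod (LINT \<xi>|lborel. g \<xi> * cis (\<xi> * y) - g \<xi> * cis (\<xi> * z))"
      by (rule arg_cong)
    also have "\<dots> \<le> (LINT \<xi>|lborel. \<bar>y - z\<bar> * w \<xi>)"
    proof (rule order.trans[OF integral_norm_bound], rule integral_mono)
      show "integrable lborel (\<lambda>\<xi>. norm (g \<xi> * cis (\<xi> * y) - g \<xi> * cis (\<xi> * z)))"
        by (intro integrable_norm Bochner_Integration.integrable_diff int_cis)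
      show "integrable lborel (\<lambda>\<xi>. \<bar>y - z\<bar> * w \<xi>)"
        using w by simp
      fix \<xi> :: real
      have "cmod (cis (\<xi> * y) - cis (\<xi> * z)) \<le> \<bar>\<xi> * y - \<xi> * z\<bar>"
        by (rule norm_cis_diff_le)
      also have "\<dots> = \<bar>y - z\<bar> * \<bar>\<xi>\<bar>"
        by (simp add: abs_mult flip: right_diff_distrib)
      also have "\<dots> \<le> \<bar>y - z\<bar> * (1 + \<xi>\<^sup>2) powr (1 / 2)"
        by (intro mult_left_mono root_ge) simp
      finally have "cmod (g \<xi>) * cmod (cis (\<xi> * y) - cis (\<xi> * z)) \<le> cmod (g \<xi>) * (\<bar>y - z\<bar> * (1 + \<xi>\<^sup>2) powr (1 / 2))"
        by (intro mult_left_mono) simp_all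
      then show "norm (g \<xi> * cis (\<xi> * y) - g \<xi> * cis (\<xi> * z)) \<le> \<bar>y - z\<bar> * w \<xi>"
        by (simp add: w_def norm_mult mult_ac flip: right_diff_distrib)
    qed
    also have "\<dots> \<le> \<bar>y - z\<bar> * C"
      using w_le by (simp add: mult_left_mono)
    finally have "2 * pi * \<bar>f y - f z\<bar> \<le> C * \<bar>y - z\<bar>"
      unfolding norm_mult norm_of_real by (simp add: mult.commute)
    moreover have "1 * \<bar>f y - f z\<bar> \<le> 2 * pi * \<bar>f y - f z\<bar>"
      using pi_gt3 by (intro mult_right_mono) auto
    ultimately show ?thesis
      by simp
  qed
  have "(f has_field_derivative deriv f x) (at x)"
    using diff[of x] by (simp add: DERIV_deriv_iff_real_differentiable)
  then have "((\<lambda>y. \<bar>(f y - f x) / (y - x)\<bar>) \<longlongrightarrow> \<bar>deriv f x\<bar>) (at x)"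
    unfolding has_field_derivative_iff by (rule tendsto_rabs)
  moreover have "\<forall>\<^sub>F y in at x. \<bar>(f y - f x) / (y - x)\<bar> \<le> C"
    using eventually_neq_at_within[of x x UNIV]
  proof eventually_elim
    case (elim y)
    then show ?case
      using lipschitz[of y x] by (simp add: abs_divide pos_divide_le_eq)
  qed
  ultimately show ?thesis
    unfolding C_def by (intro tendsto_upperbound) auto
qed

section \<open>The resolvent as a sum of two half-line averages\<close>

text \<open>The convolution of \<open>f\<close> with the part of the resolvent kernel \<open>exp (- \<bar>z\<bar> / c) / (2 * c)\<close> on
\<open>z \<ge> 0\<close>; it averages \<open>f\<close> over the half-line to the left of \<open>x\<close>. Integrating in
the distance \<open>z\<close> keeps the domain and the weight independent of \<open>x\<close>.\<close>

definition left_average :: "real \<Rightarrow> (real \<Rightarrow> real) \<Rightarrow> real \<Rightarrow> real" where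
  "left_average c f x = (LINT z|lborel. indicator {0..} z * exp (- z / c) * f (x - z)) / (2 * c)"

definition right_average :: "real \<Rightarrow> (real \<Rightarrow> real) \<Rightarrow> real \<Rightarrow> real" where
  "right_average c f x = (LINT z|lborel. indicator {0..} z * exp (- z / c) * f (x + z)) / (2 * c)"

lemma right_average_reflect: "right_average c f x = left_average c (\<lambda>y. f (- y)) (- x)"
  by (simp add: right_average_def left_average_def add.commute)

lemma integrable_exp_decay:
  assumes "c > 0"
  shows "integrable lborel (\<lambda>z::real. indicator {0..} z * exp (- z / c))"
proof -
  have "(\<lambda>z. exp (- (1 / c) * z)) integrable_on {0..}"
    using assms by (intro integrable_on_exp_minus_to_infinity) simp
  then have "(\<lambda>z. exp (- z / c)) absolutely_integrable_on {0..}"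
    by (intro nonnegative_absolutely_integrable_1) simp_all
  then have "integrable lebesgue (\<lambda>z. indicator {0..} z * exp (- z / c))"
    by (simp add: set_integrable_def)
  then show ?thesis
    by (simp add: integrable_completion)
qed

lemma integrable_average:
  fixes f :: "real \<Rightarrow> real"
  assumes "c > 0" and [measurable]: "f \<in> borel_measurable borel" and M: "\<And>x. \<bar>f x\<bar> \<le> M"
  shows "integrable lborel (\<lambda>z. indicator {0..} z * exp (- z / c) * f (x - z))"
proof (rule Bochner_Integration.integrable_bound)
  show "integrable lborel (\<lambda>z. M * (indicator {0..} z * exp (- z / c)))"
    by (intro integrable_mult_right integrable_exp_decay[OF \<open>c > 0\<close>])
  have "0 \<le> M"
    using M[of 0] by linarith
  have "indicator {0..} z * exp (- z / c) * \<bar>f (x - z)\<bar> \<le> indicator {0..} z * exp (- z / c) * M" for z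
    by (intro mult_left_mono M) simp
  then show "AE z in lborel. norm (indicator {0..} z * exp (- z / c) * f (x - z))
      \<le> norm (M * (indicator {0..} z * exp (- z / c)))"
    using \<open>0 \<le> M\<close> by (intro AE_I2) (simp add: abs_mult mult_ac)
qed measurable

lemma left_average_bounded:
  fixes f :: "real \<Rightarrow> real"
  assumes "c > 0" and [measurable]: "f \<in> borel_measurable borel" and M: "\<And>x. \<bar>f x\<bar> \<le> M"
  shows "\<bar>left_average c f x\<bar> \<le> M * left_average c (\<lambda>_. 1) 0"
proof -
  have "\<bar>LINT z|lborel. indicator {0..} z * exp (- z / c) * f (x - z)\<bar>
      \<le> (LINT z|lborel. M * (indicator {0..} z * exp (- z / c)))"
  proof (rule order.trans[OF integral_abs_bound], rule integral_mono)
    show "integrable lborel (\<lambda>z. \<bar>indicator {0..} z * exp (- z / c) * f (x - z)\<bar>)"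
      by (intro integrable_abs integrable_average[OF \<open>c > 0\<close> _ M]) measurable
    show "integrable lborel (\<lambda>z. M * (indicator {0..} z * exp (- z / c)))"
      by (intro integrable_mult_right integrable_exp_decay[OF \<open>c > 0\<close>])
    show "\<bar>indicator {0..} z * exp (- z / c) * f (x - z)\<bar> \<le> M * (indicator {0..} z * exp (- z / c))" for z
      using mult_left_mono[OF M, of "indicator {0..} z * exp (- z / c)" "x - z"]
      by (simp add: abs_mult mult_ac)
  qed
  then show ?thesis
    using \<open>c > 0\<close> by (simp add: left_average_def divide_right_mono abs_divide)
qed

text \<open>In the variable \<open>u = x - z\<close> the average is \<open>exp (- x / c)\<close> times a primitive of
\<open>exp (u / c) * f u\<close>, so the fundamental theorem of calculus and the product rule apply.\<close>

lemma left_average_has_derivative: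
  assumes "c > 0" and cont: "continuous_on UNIV f" and M: "\<And>x. \<bar>f x\<bar> \<le> M"
  shows "(left_average c f has_real_derivative f x / (2 * c) - left_average c f x / c) (at x)"
proof -
  have [measurable]: "f \<in> borel_measurable borel"
    using cont by (rule borel_measurable_continuous_onI)
  define h where "h = (\<lambda>y. exp (y / c) * f y)"
  have h_cont: "continuous_on S h" for S
    unfolding h_def by (intro continuous_intros continuous_on_subset[OF cont]) (use \<open>c > 0\<close> in auto)
  have [measurable]: "h \<in> borel_measurable borel"
    using h_cont by (rule borel_measurable_continuous_onI)
  define H where "H = (\<lambda>y. LINT u|lborel. indicator {..y} u * h u)"
  have shift: "indicator {0..} (y - u) * exp (- (y - u) / c) * f u = exp (- y / c) * (indicator {..y} u * h u)" for y u
    by (auto simp: h_def indicator_def diff_divide_distrib exp_diff exp_minus field_simps)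
  have int_shift: "integrable lborel (\<lambda>u. indicator {..y} u * h u)" for y
  proof -
    have "integrable lborel (\<lambda>z. indicator {0..} z * exp (- z / c) * f (y - z))"
      by (rule integrable_average[OF \<open>c > 0\<close> _ M]) measurable
    from lborel_integrable_real_affine[OF this, of "-1" y]
    have "integrable lborel (\<lambda>u. indicator {0..} (y - u) * exp (- (y - u) / c) * f u)"
      by simp
    then have "integrable lborel (\<lambda>u. exp (y / c) * (exp (- y / c) * (indicator {..y} u * h u)))"
      using shift by (intro integrable_mult_right) simp
    then show ?thesis
      by (simp add: mult.assoc[symmetric] exp_add[symmetric])
  qed
  have avg: "left_average c f y = exp (- y / c) * H y / (2 * c)" for y
  proof -
    have "(LINT z|lborel. indicator {0..} z * exp (- z / c) * f (y - z))
        = (LINT u|lborel. indicator {0..} (y - u) * exp (- (y - u) / c) * f u)"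
      by (subst lborel_integral_real_affine[where c = "-1" and t = y]) auto
    also have "\<dots> = exp (- y / c) * H y"
      unfolding shift H_def by simp
    finally show ?thesis
      by (simp add: left_average_def)
  qed
  \<comment> \<open>Any base point to the left of \<open>x\<close> would do.\<close>
  define a where "a = x - 1"
  have H_split: "H y = H a + integral {a..y} h" if "a \<le> y" for y
  proof -
    have "(h has_integral integral {a..y} h) {a..y}"
      by (intro integrable_integral integrable_continuous_real h_cont)
    have int_Icc: "set_integrable lborel {a..y} h"
      by (intro borel_integrable_atLeastAtMost' h_cont)
    then have "integral {a..y} h = (LINT u|lborel. indicator {a..y} u * h u)"
      using set_borel_integral_eq_integral(2)[OF int_Icc] by (simp add: set_lebesgue_integral_def)
    moreover have "H y = (LINT u|lborel. indicator {..a} u * h u + indicator {a..y} u * h u)"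
      unfolding H_def
    proof (rule integral_cong_AE)
      show "AE u in lborel. indicator {..y} u * h u = indicator {..a} u * h u + indicator {a..y} u * h u"
        using AE_lborel_singleton[of a] by eventually_elim (use that in \<open>auto simp: indicator_def\<close>)
    qed measurable
    moreover have "integrable lborel (\<lambda>u. indicator {a..y} u * h u)"
      using int_Icc by (simp add: set_integrable_def)
    ultimately show ?thesis
      using int_shift[of a] by (simp add: H_def)
  qed
  have "((\<lambda>y. integral {a..y} h) has_real_derivative h x) (at x within {a..x + 1})"
    by (rule integral_has_real_derivative[OF h_cont]) (simp add: a_def)
  then have "((\<lambda>y. integral {a..y} h) has_real_derivative h x) (at x)"
    by (simp add: at_within_Icc_at a_def)
  then have "((\<lambda>y. H a + integral {a..y} h) has_real_derivative h x) (at x)"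
    by (auto intro!: derivative_eq_intros)
  then have "(H has_real_derivative h x) (at x)"
  proof (rule has_field_derivative_transform_within[where d = 1])
    show "H a + integral {a..y} h = H y" if "dist y x < 1" for y
      using that by (intro H_split[symmetric]) (auto simp: a_def dist_real_def)
  qed simp_all
  then have "((\<lambda>y. exp (- y / c) * H y / (2 * c)) has_real_derivative
      (exp (- x / c) * (- 1 / c) * H x + h x * exp (- x / c)) / (2 * c)) (at x)"
    using \<open>c > 0\<close> by (auto intro!: derivative_eq_intros simp: field_simps)
  moreover have "(exp (- x / c) * (- 1 / c) * H x + h x * exp (- x / c)) / (2 * c)
      = f x / (2 * c) - left_average c f x / c"
  proof -
    have "h x * exp (- x / c) = f x"
      by (simp add: h_def exp_minus)
    then show ?thesis
      using \<open>c > 0\<close> by (simp add: avg field_simps)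
  qed
  moreover have "left_average c f = (\<lambda>y. exp (- y / c) * H y / (2 * c))"
    by (rule ext) (rule avg)
  ultimately show ?thesis
    by simp
qed

lemma right_average_has_derivative:
  assumes "c > 0" and cont: "continuous_on UNIV f" and M: "\<And>x. \<bar>f x\<bar> \<le> M"
  shows "(right_average c f has_real_derivative right_average c f x / c - f x / (2 * c)) (at x)"
proof -
  have "continuous_on UNIV (\<lambda>y. f (- y))"
    by (intro continuous_on_compose2[OF cont] continuous_intros) auto
  then have "(left_average c (\<lambda>y. f (- y)) has_real_derivative
      f x / (2 * c) - right_average c f x / c) (at (- x))"
    using left_average_has_derivative[OF \<open>c > 0\<close>, of "\<lambda>y. f (- y)" M "- x"] M
    by (simp add: right_average_reflect)
  then have "((\<lambda>y. left_average c (\<lambda>y. f (- y)) (- y)) has_real_derivative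
      (f x / (2 * c) - right_average c f x / c) * (- 1)) (at x)"
    by (rule DERIV_chain2) (auto intro!: derivative_eq_intros)
  then show ?thesis
    by (simp add: right_average_reflect[abs_def])
qed

lemma helmholtz_inverse_eq_averages:
  assumes "d \<ge> 1" and [measurable]: "f \<in> borel_measurable borel" and M: "\<And>x. \<bar>f x\<bar> \<le> M"
  shows "helmholtz_inverse d f x = left_average (sqrt (real d)) f x + right_average (sqrt (real d)) f x"
proof -
  define c where "c = sqrt (real d)"
  have "c > 0"
    using assms(1) by (simp add: c_def)
  define A where "A = (\<lambda>z. indicator {0..} z * exp (- z / c) * f (x - z))"
  define B where "B = (\<lambda>z. indicator {0..} z * exp (- z / c) * f (x + z))"
  have A: "integrable lborel A"
    unfolding A_def by (rule integrable_average[OF \<open>c > 0\<close> _ M]) measurable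
  have "integrable lborel (\<lambda>z. indicator {0..} z * exp (- z / c) * f (- (- x - z)))"
    by (rule integrable_average[OF \<open>c > 0\<close>, of "\<lambda>y. f (- y)" M "- x"]) (use M in auto)
  then have B: "integrable lborel B"
    by (simp add: B_def add.commute)
  have B': "integrable lborel (\<lambda>z. B (- z))"
    using lborel_integrable_real_affine[OF B, of "-1" 0] by simp
  have B'_eq: "(LINT z|lborel. B (- z)) = (LINT z|lborel. B z)"
    by (subst (2) lborel_integral_real_affine[where c = "-1" and t = 0]) auto
  have "helmholtz_inverse d f x = (LINT z|lborel. p_kernel d z * f (x - z))"
    unfolding helmholtz_inverse_def
    by (subst lborel_integral_real_affine[where c = "-1" and t = x]) auto
  also have "\<dots> = (LINT z|lborel. (A z + B (- z)) / (2 * c))"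
  proof (rule integral_cong_AE)
    show "AE z in lborel. p_kernel d z * f (x - z) = (A z + B (- z)) / (2 * c)"
      using AE_lborel_singleton[of 0]
      by eventually_elim (auto simp: p_kernel_def A_def B_def c_def indicator_def abs_if)
    show "(\<lambda>z. p_kernel d z * f (x - z)) \<in> borel_measurable lborel"
      unfolding p_kernel_def by measurable
    show "(\<lambda>z. (A z + B (- z)) / (2 * c)) \<in> borel_measurable lborel"
      unfolding A_def B_def by measurable
  qed
  also have "\<dots> = ((LINT z|lborel. A z) + (LINT z|lborel. B z)) / (2 * c)"
    using A B' by (simp add: B'_eq)
  also have "\<dots> = left_average c f x + right_average c f x"
    by (simp add: left_average_def right_average_def A_def B_def add_divide_distrib)
  finally show ?thesis
    by (simp add: c_def)
qed

text \<open>The function \<open>K y = exp (y / c) * (left_average c f y - c\<^sup>2 / 4 * (u y)\<^sup>2)\<close> tends to 0 at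
\<open>-\<infinity>\<close>, and its derivative is the nonnegative function \<open>exp (y / c) * (c / 4) * (u y - c * u' y)\<^sup>2\<close>:
the source is exactly large enough to complete this square.\<close>

lemma left_average_lower_bound:
  fixes u u' :: "real \<Rightarrow> real"
  assumes "c > 0"
    and u: "\<And>x. (u has_real_derivative u' x) (at x)" and u': "continuous_on UNIV u'"
    and M: "\<And>x. \<bar>u x\<bar> \<le> M" and M': "\<And>x. \<bar>u' x\<bar> \<le> M'"
  shows "c\<^sup>2 / 4 * (u x)\<^sup>2 \<le> left_average c (\<lambda>y. c\<^sup>2 * (u y)\<^sup>2 + (c\<^sup>2)\<^sup>2 / 2 * (u' y)\<^sup>2) x"
proof -
  define f where "f = (\<lambda>y. c\<^sup>2 * (u y)\<^sup>2 + (c\<^sup>2)\<^sup>2 / 2 * (u' y)\<^sup>2)"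
  define B where "B = c\<^sup>2 * M\<^sup>2 + (c\<^sup>2)\<^sup>2 / 2 * M'\<^sup>2"
  have u_cont: "continuous_on UNIV u"
    using u by (intro DERIV_continuous_on[where D = u']) (auto intro: has_field_derivative_at_within)
  have f_cont: "continuous_on UNIV f"
    unfolding f_def by (intro continuous_intros u_cont u')
  have sq: "(u y)\<^sup>2 \<le> M\<^sup>2" "(u' y)\<^sup>2 \<le> M'\<^sup>2" for y
    using M[of y] M'[of y] by (simp_all add: abs_le_square_iff[symmetric])
  have f_bound: "\<bar>f y\<bar> \<le> B" for y
    unfolding f_def B_def using sq[of y] by (simp add: add_mono mult_left_mono)
  define K where "K = (\<lambda>y. exp (y / c) * (left_average c f y - c\<^sup>2 / 4 * (u y)\<^sup>2))"
  define K' where "K' = (\<lambda>y. exp (y / c) * (1 / c) * (left_average c f y - c\<^sup>2 / 4 * (u y)\<^sup>2)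
      + exp (y / c) * ((f y / (2 * c) - left_average c f y / c) - c\<^sup>2 / 4 * (2 * u y * u' y)))"
  have K_deriv: "(K has_real_derivative K' y) (at y)" for y
    unfolding K_def K'_def using \<open>c > 0\<close>
    by (auto intro!: derivative_eq_intros u left_average_has_derivative[OF \<open>c > 0\<close> f_cont f_bound] simp: algebra_simps)
  have K'_eq: "K' y = exp (y / c) * (c / 4 * (u y - c * u' y)\<^sup>2)" for y
    unfolding K'_def f_def using \<open>c > 0\<close> by (simp add: field_simps power2_eq_square)
  have K_mono: "K y \<le> K x" if "y \<le> x" for y
    using that by (rule DERIV_nonneg_imp_nondecreasing) (use K_deriv K'_eq \<open>c > 0\<close> in force)
  have "0 \<le> K x"
  proof (rule tendsto_upperbound)
    define C where "C = B * left_average c (\<lambda>_. 1) 0 + c\<^sup>2 / 4 * M\<^sup>2"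
    have "\<bar>left_average c f y - c\<^sup>2 / 4 * (u y)\<^sup>2\<bar> \<le> C" for y
    proof -
      have "\<bar>left_average c f y\<bar> \<le> B * left_average c (\<lambda>_. 1) 0"
        by (rule left_average_bounded[OF \<open>c > 0\<close> borel_measurable_continuous_onI[OF f_cont] f_bound])
      moreover have "0 \<le> c\<^sup>2 / 4 * (u y)\<^sup>2" "c\<^sup>2 / 4 * (u y)\<^sup>2 \<le> c\<^sup>2 / 4 * M\<^sup>2"
        using sq by (auto intro: mult_left_mono)
      ultimately show ?thesis
        unfolding C_def by linarith
    qed
    then have K_le: "norm (K y) \<le> exp (y / c) * C" for y
      by (simp add: K_def abs_mult mult_left_mono)
    have "((\<lambda>y. exp (y / c) * C) \<longlongrightarrow> 0) at_bot"
    proof (rule tendsto_mult_left_zero, rule filterlim_compose[OF exp_at_bot])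
      show "filterlim (\<lambda>y. y / c) at_bot at_bot"
        using filterlim_tendsto_pos_mult_at_bot[OF tendsto_const[of "1 / c"] _ filterlim_ident] \<open>c > 0\<close>
        by simp
    qed
    then show "(K \<longlongrightarrow> 0) at_bot"
      by (rule Lim_null_comparison[OF always_eventually[OF allI[OF K_le]]])
    show "\<forall>\<^sub>F y in at_bot. K y \<le> K x"
      using eventually_le_at_bot[of x] by eventually_elim (rule K_mono)
  qed simp
  then show ?thesis
    by (simp add: K_def f_def zero_le_mult_iff)
qed

lemma right_average_lower_bound:
  fixes u u' :: "real \<Rightarrow> real"
  assumes "c > 0"
    and u: "\<And>x. (u has_real_derivative u' x) (at x)" and u': "continuous_on UNIV u'"
    and M: "\<And>x. \<bar>u x\<bar> \<le> M" and M': "\<And>x. \<bar>u' x\<bar> \<le> M'"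
  shows "c\<^sup>2 / 4 * (u x)\<^sup>2 \<le> right_average c (\<lambda>y. c\<^sup>2 * (u y)\<^sup>2 + (c\<^sup>2)\<^sup>2 / 2 * (u' y)\<^sup>2) x"
proof -
  have "((\<lambda>y. u (- y)) has_real_derivative - u' (- y)) (at y)" for y
  proof -
    have "((\<lambda>y. u (- y)) has_real_derivative u' (- y) * (- 1)) (at y)"
      by (rule DERIV_chain2[where f = u, OF u]) (auto intro!: derivative_eq_intros)
    then show ?thesis
      by simp
  qed
  moreover have "continuous_on UNIV (\<lambda>y. - u' (- y))"
    by (intro continuous_intros continuous_on_compose2[OF u']) auto
  ultimately show ?thesis
    using left_average_lower_bound[of c "\<lambda>y. u (- y)" "\<lambda>y. - u' (- y)" M M' "- x"] assms
    by (simp add: right_average_reflect)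
qed

section \<open>Global flows of bounded Lipschitz vector fields\<close>

text \<open>Picard's theorem for all positive times at once: with the unknown \<open>y t = exp (- K * t) * (q t - x0)\<close> and
\<open>K = 2 * L\<close>, the integral operator is a contraction by the factor \<open>1/2\<close> on the bounded continuous
functions, whatever the length of the time interval.\<close>

lemma global_lipschitz_flow:
  fixes b :: "real \<Rightarrow> real \<Rightarrow> real"
  assumes cont: "continuous_on UNIV (\<lambda>(t, x). b t x)"
    and M: "\<And>t x. \<bar>b t x\<bar> \<le> M"
    and L: "\<And>t x y. \<bar>b t x - b t y\<bar> \<le> L * \<bar>x - y\<bar>" and "L > 0"
  obtains q where "q 0 = x0" "\<And>t. t \<ge> 0 \<Longrightarrow> (q has_real_derivative b t (q t)) (at t within {0..})"
proof -
  define K where "K = 2 * L"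
  have "K > 0"
    using \<open>L > 0\<close> by (simp add: K_def)
  have "M \<ge> 0"
    using M[of 0 0] by linarith
  define g where "g = (\<lambda>(y :: real \<Rightarrow>\<^sub>C real) \<tau>. b \<tau> (x0 + exp (K * \<tau>) * apply_bcontfun y \<tau>))"
  have g_cont: "continuous_on A (g y)" for A y
  proof -
    have "continuous_on A (\<lambda>\<tau>. case (\<tau>, x0 + exp (K * \<tau>) * apply_bcontfun y \<tau>) of (t, x) \<Rightarrow> b t x)"
      by (rule continuous_on_compose2[OF cont]) (auto intro!: continuous_intros)
    then show ?thesis
      by (simp add: g_def)
  qed
  have g_int: "g y integrable_on {0..t}" for y t
    by (intro integrable_continuous_real g_cont)
  have g_deriv: "((\<lambda>t. integral {0..t} (g y)) has_real_derivative g y t) (at t within {0..})" if "t \<ge> 0" for y t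
  proof -
    have "((\<lambda>t. integral {0..t} (g y)) has_real_derivative g y t) (at t within {0..t + 1})"
      by (rule integral_has_real_derivative[OF g_cont]) (use that in auto)
    moreover have "at t within {0..t + 1} = at t within {0..}"
      by (rule at_within_nhd[where S = "{..<t + 1}"]) auto
    ultimately show ?thesis
      by simp
  qed
  \<comment> \<open>Negative times are sent to 0, so that the fixed point is sought among functions on the whole line.\<close>
  define \<Phi> where "\<Phi> = (\<lambda>y t. exp (- (K * max 0 t)) * integral {0..max 0 t} (g y))"
  have \<Phi>_cont: "continuous_on UNIV (\<Phi> y)" for y
  proof -
    have "continuous_on {0..} (\<lambda>t. integral {0..t} (g y))"
      using g_deriv by (intro DERIV_continuous_on) auto
    then have "continuous_on UNIV (\<lambda>t. integral {0..max 0 t} (g y))"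
      by (rule continuous_on_compose2) (auto intro!: continuous_intros)
    then show ?thesis
      unfolding \<Phi>_def by (intro continuous_intros)
  qed
  have \<Phi>_diff: "\<bar>exp (- (K * s)) * integral {0..s} h\<bar> \<le> B / K"
    if "s \<ge> 0" "h integrable_on {0..s}" and h: "\<And>\<tau>. \<tau> \<in> {0..s} \<Longrightarrow> \<bar>h \<tau>\<bar> \<le> B * exp (K * \<tau>)" and "B \<ge> 0" for s h B
  proof -
    have "((\<lambda>\<tau>. B * exp (K * \<tau>)) has_integral B * exp (K * s) / K - B * exp (K * 0) / K) {0..s}"
      using \<open>s \<ge> 0\<close> \<open>K > 0\<close>
      by (intro fundamental_theorem_of_calculus)
         (auto intro!: derivative_eq_intros simp flip: has_real_derivative_iff_has_vector_derivative)
    then have "\<bar>integral {0..s} h\<bar> \<le> B * exp (K * s) / K - B * exp (K * 0) / K"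
      using integral_norm_bound_integral[OF \<open>h integrable_on {0..s}\<close>, of "\<lambda>\<tau>. B * exp (K * \<tau>)"] h
      by (auto simp: has_integral_iff)
    also have "\<dots> \<le> B * exp (K * s) / K"
      using \<open>K > 0\<close> \<open>B \<ge> 0\<close> by simp
    finally have "\<bar>integral {0..s} h\<bar> \<le> B * exp (K * s) / K" .
    then have "exp (- (K * s)) * \<bar>integral {0..s} h\<bar> \<le> exp (- (K * s)) * (B * exp (K * s) / K)"
      by (intro mult_left_mono) simp_all
    also have "\<dots> = B / K"
      by (simp add: exp_minus)
    finally show ?thesis
      by (simp add: abs_mult)
  qed
  have \<Phi>_bound: "\<bar>\<Phi> y t\<bar> \<le> M / K" for y t
    unfolding \<Phi>_def
  proof (rule \<Phi>_diff)
    fix \<tau> assume "\<tau> \<in> {0..max 0 t}"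
    then have "M * 1 \<le> M * exp (K * \<tau>)"
      using \<open>K > 0\<close> \<open>M \<ge> 0\<close> by (intro mult_left_mono) auto
    then show "\<bar>g y \<tau>\<bar> \<le> M * exp (K * \<tau>)"
      using M[of \<tau> "x0 + exp (K * \<tau>) * apply_bcontfun y \<tau>"] by (simp add: g_def)
  qed (use g_int \<open>M \<ge> 0\<close> in auto)
  have \<Phi>_bcontfun: "\<Phi> y \<in> bcontfun" for y
    using \<Phi>_cont \<Phi>_bound by (intro bcontfun_normI[where b = "M / K"]) auto
  define \<Psi> where "\<Psi> = (\<lambda>y. Bcontfun (\<Phi> y))"
  have apply_\<Psi>: "apply_bcontfun (\<Psi> y) = \<Phi> y" for y
    by (simp add: \<Psi>_def Bcontfun_inverse[OF \<Phi>_bcontfun])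
  have contraction: "dist (\<Psi> y) (\<Psi> z) \<le> 1 / 2 * dist y z" for y z
  proof (rule dist_bound)
    fix t :: real
    let ?s = "max 0 t"
    have "\<Phi> y t - \<Phi> z t = exp (- (K * ?s)) * integral {0..?s} (\<lambda>\<tau>. g y \<tau> - g z \<tau>)"
      by (simp add: \<Phi>_def Henstock_Kurzweil_Integration.integral_diff[OF g_int g_int] right_diff_distrib)
    also have "\<bar>\<dots>\<bar> \<le> L * dist y z / K"
    proof (rule \<Phi>_diff)
      fix \<tau>
      have "\<bar>g y \<tau> - g z \<tau>\<bar> \<le> L * \<bar>exp (K * \<tau>) * (apply_bcontfun y \<tau> - apply_bcontfun z \<tau>)\<bar>"
        unfolding g_def using L[of \<tau> "x0 + exp (K * \<tau>) * apply_bcontfun y \<tau>" "x0 + exp (K * \<tau>) * apply_bcontfun z \<tau>"]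
        by (simp add: right_diff_distrib)
      also have "\<dots> = L * (exp (K * \<tau>) * dist (apply_bcontfun y \<tau>) (apply_bcontfun z \<tau>))"
        by (simp add: abs_mult dist_real_def)
      also have "\<dots> \<le> L * (exp (K * \<tau>) * dist y z)"
        using \<open>L > 0\<close> by (intro mult_left_mono dist_bounded) auto
      finally show "\<bar>g y \<tau> - g z \<tau>\<bar> \<le> L * dist y z * exp (K * \<tau>)"
        by (simp add: mult_ac)
    qed (use g_int \<open>L > 0\<close> in \<open>auto intro: Henstock_Kurzweil_Integration.integrable_diff\<close>)
    finally show "dist (apply_bcontfun (\<Psi> y) t) (apply_bcontfun (\<Psi> z) t) \<le> 1 / 2 * dist y z"
      using \<open>L > 0\<close> by (simp add: apply_\<Psi> dist_real_def K_def)
  qed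
  have "\<exists>!y. \<Psi> y = y"
    by (rule banach_fix_type[OF _ _ allI[OF allI[OF contraction]]]) simp_all
  then obtain y where y: "\<Psi> y = y"
    by auto
  define q where "q = (\<lambda>t. x0 + integral {0..t} (g y))"
  have y_eq: "apply_bcontfun y t = exp (- (K * t)) * integral {0..t} (g y)" if "t \<ge> 0" for t
    using apply_\<Psi>[of y] that by (simp add: y \<Phi>_def)
  have "x0 + exp (K * t) * apply_bcontfun y t = q t" if "t \<ge> 0" for t
    using y_eq[OF that] by (simp add: q_def exp_minus)
  then have g_eq: "g y t = b t (q t)" if "t \<ge> 0" for t
    using that by (simp add: g_def)
  show thesis
  proof
    show "q 0 = x0"
      by (simp add: q_def)
    show "(q has_real_derivative b t (q t)) (at t within {0..})" if "t \<ge> 0" for t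
      unfolding q_def using g_deriv[OF that, of y] g_eq[OF that]
      by (auto intro!: derivative_eq_intros simp: q_def)
  qed
qed

section \<open>Blow-up of two mutually reinforcing quantities\<close>

lemma mono_of_derivative_nonneg:
  fixes f f' :: "real \<Rightarrow> real"
  assumes "a \<le> b"
    and "\<And>t. t \<in> {a..b} \<Longrightarrow> (f has_real_derivative f' t) (at t within {a..b})"
    and "\<And>t. t \<in> {a..b} \<Longrightarrow> f' t \<ge> 0"
  shows "f a \<le> f b"
proof -
  have "(f' has_integral f b - f a) {a..b}"
    using assms(1,2) by (intro fundamental_theorem_of_calculus) (auto simp flip: has_real_derivative_iff_has_vector_derivative)
  then have "0 \<le> f b - f a"
    using assms(3) by (rule has_integral_nonneg)
  then show ?thesis
    by simp
qed

text \<open>Before the first time at which one of the two functions fails to be positive, both derivatives are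
nonnegative; so at that time both functions are still at least their initial values.\<close>

lemma coupled_growth_positive:
  fixes A C A' C' :: "real \<Rightarrow> real"
  assumes "S \<ge> 0" "k > 0"
    and A: "\<And>t. t \<in> {0..S} \<Longrightarrow> (A has_real_derivative A' t) (at t within {0..S})"
    and C: "\<And>t. t \<in> {0..S} \<Longrightarrow> (C has_real_derivative C' t) (at t within {0..S})"
    and A': "\<And>t. t \<in> {0..S} \<Longrightarrow> A' t \<ge> k * (A t * C t)"
    and C': "\<And>t. t \<in> {0..S} \<Longrightarrow> C' t \<ge> k * (A t * C t)"
    and pos: "A 0 > 0" "C 0 > 0" and t: "t \<in> {0..S}"
  shows "A t > 0 \<and> C t > 0"
proof (rule ccontr)
  assume contr: "\<not> (A t > 0 \<and> C t > 0)"
  have A_cont: "continuous_on {0..S} A" and C_cont: "continuous_on {0..S} C"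
    using DERIV_continuous_on[OF A] DERIV_continuous_on[OF C] by blast+
  define Z where "Z = {t \<in> {0..S}. min (A t) (C t) \<le> 0}"
  have "continuous_on {0..S} (\<lambda>t. min (A t) (C t))"
    by (intro continuous_intros A_cont C_cont)
  then have "closed ({0..S} \<inter> (\<lambda>t. min (A t) (C t)) -` {..0})"
    by (rule continuous_closed_preimage) simp_all
  also have "{0..S} \<inter> (\<lambda>t. min (A t) (C t)) -` {..0} = Z"
    by (auto simp: Z_def)
  finally have "closed Z" .
  have "t \<in> Z"
    using contr t by (auto simp: Z_def min_le_iff_disj)
  have "bdd_below Z"
    by (rule bdd_belowI[where m = 0]) (auto simp: Z_def)
  define r where "r = Inf Z"
  have "r \<in> Z"
    unfolding r_def using \<open>closed Z\<close> \<open>t \<in> Z\<close> \<open>bdd_below Z\<close> by (intro closed_contains_Inf) auto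
  then have r: "r \<in> {0..S}" "min (A r) (C r) \<le> 0"
    by (auto simp: Z_def)
  have before: "A u > 0 \<and> C u > 0" if "u \<in> {0..<r}" for u
  proof (rule ccontr)
    assume "\<not> (A u > 0 \<and> C u > 0)"
    then have "u \<in> Z"
      using that r by (auto simp: Z_def min_le_iff_disj)
    then have "r \<le> u"
      unfolding r_def using \<open>bdd_below Z\<close> by (rule cInf_lower)
    with that show False by simp
  qed
  have sub: "{0..u} \<subseteq> {0..S}" if "u < r" for u
    using that r by auto
  have le: "A 0 \<le> A u \<and> C 0 \<le> C u" if u: "u \<in> {0..<r}" for u
  proof
    have nonneg: "A' w \<ge> 0 \<and> C' w \<ge> 0" if "w \<in> {0..u}" for w
    proof -
      have "A w > 0 \<and> C w > 0"
        using before[of w] that u by simp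
      then have "k * (A w * C w) \<ge> 0"
        using \<open>k > 0\<close> by simp
      then show ?thesis
        using A'[of w] C'[of w] that u r by auto
    qed
    show "A 0 \<le> A u"
      by (rule mono_of_derivative_nonneg[where f' = A'])
         (use u sub nonneg in \<open>auto intro!: DERIV_subset[OF A]\<close>)
    show "C 0 \<le> C u"
      by (rule mono_of_derivative_nonneg[where f' = C'])
         (use u sub nonneg in \<open>auto intro!: DERIV_subset[OF C]\<close>)
  qed
  have "r \<noteq> 0"
    using r pos by (auto simp: min_le_iff_disj)
  then have "r > 0"
    using r by simp
  have lim: "(f \<longlongrightarrow> f r) (at_left r)" if "continuous_on {0..S} f" for f :: "real \<Rightarrow> real"
  proof -
    have "(f \<longlongrightarrow> f r) (at r within {0..S})"
      using that r by (simp add: continuous_on_def)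
    then have "(f \<longlongrightarrow> f r) (at r within {0..<r})"
      by (rule tendsto_within_subset) (use r in auto)
    moreover have "at r within {0..<r} = at_left r"
      by (rule at_within_nhd[where S = "{0<..}"]) (use \<open>r > 0\<close> in auto)
    ultimately show ?thesis
      by simp
  qed
  have near: "\<forall>\<^sub>F u in at_left r. u \<in> {0..<r}"
    using \<open>r > 0\<close> by (auto simp: eventually_at_left_field intro!: exI[of _ 0])
  have "A 0 \<le> A r"
    by (rule tendsto_lowerbound[OF lim[OF A_cont]]) (use near le in \<open>auto elim: eventually_mono\<close>)
  moreover have "C 0 \<le> C r"
    by (rule tendsto_lowerbound[OF lim[OF C_cont]]) (use near le in \<open>auto elim: eventually_mono\<close>)
  ultimately show False
    using r pos by (auto simp: min_le_iff_disj)
qed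

text \<open>The derivative of \<open>1 / A + 1 / C\<close> is at most \<open>- k * (C / A + A / C) \<le> - 2 * k\<close>. The sum starts at
\<open>1 / A 0 + 1 / C 0\<close> and stays positive, which limits the length of the time interval.\<close>

lemma coupled_growth_blowup:
  fixes A C A' C' :: "real \<Rightarrow> real"
  assumes "S \<ge> 0" "k > 0"
    and A: "\<And>t. t \<in> {0..S} \<Longrightarrow> (A has_real_derivative A' t) (at t within {0..S})"
    and C: "\<And>t. t \<in> {0..S} \<Longrightarrow> (C has_real_derivative C' t) (at t within {0..S})"
    and A': "\<And>t. t \<in> {0..S} \<Longrightarrow> A' t \<ge> k * (A t * C t)"
    and C': "\<And>t. t \<in> {0..S} \<Longrightarrow> C' t \<ge> k * (A t * C t)"
    and pos: "A 0 > 0" "C 0 > 0"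
  shows "2 * k * S < 1 / A 0 + 1 / C 0"
proof -
  have AC: "A t > 0" "C t > 0" if "t \<in> {0..S}" for t
    using coupled_growth_positive[OF assms that] by auto
  \<comment> \<open>the negative of \<open>1 / A + 1 / C + 2 * k * t\<close>, which is nondecreasing\<close>
  define \<phi> where "\<phi> = (\<lambda>t. - (1 / A t) - 1 / C t - 2 * k * t)"
  define \<phi>' where "\<phi>' = (\<lambda>t. A' t / (A t)\<^sup>2 + C' t / (C t)\<^sup>2 - 2 * k)"
  have "\<phi> 0 \<le> \<phi> S"
  proof (rule mono_of_derivative_nonneg[OF \<open>S \<ge> 0\<close>])
    fix t assume t: "t \<in> {0..S}"
    show "(\<phi> has_real_derivative \<phi>' t) (at t within {0..S})"
      unfolding \<phi>_def \<phi>'_def using AC[OF t] 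
      by (auto intro!: derivative_eq_intros A[OF t] C[OF t] simp: power2_eq_square)
    have "A' t / (A t)\<^sup>2 \<ge> k * (A t * C t) / (A t)\<^sup>2"
      by (intro divide_right_mono A'[OF t]) simp
    moreover have "C' t / (C t)\<^sup>2 \<ge> k * (A t * C t) / (C t)\<^sup>2"
      by (intro divide_right_mono C'[OF t]) simp
    moreover have "k * (A t * C t) / (A t)\<^sup>2 + k * (A t * C t) / (C t)\<^sup>2 = k * (C t / A t + A t / C t)"
      using AC[OF t] by (simp add: field_simps power2_eq_square)
    moreover have "C t / A t + A t / C t \<ge> 2"
    proof -
      have "C t / A t + A t / C t - 2 = (A t - C t)\<^sup>2 / (A t * C t)"
        using AC[OF t] by (simp add: field_simps power2_eq_square)
      also have "\<dots> \<ge> 0"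
        using AC[OF t] by simp
      finally show ?thesis
        by simp
    qed
    then have "k * (C t / A t + A t / C t) \<ge> k * 2"
      using \<open>k > 0\<close> by (intro mult_left_mono) simp_all
    ultimately show "\<phi>' t \<ge> 0"
      unfolding \<phi>'_def by linarith
  qed
  moreover have "1 / A S > 0" "1 / C S > 0"
    using AC[of S] \<open>S \<ge> 0\<close> by simp_all
  ultimately show ?thesis
    unfolding \<phi>_def by linarith
qed

section \<open>Time continuity that is uniform in space\<close>

lemma continuous_on_of_uniformly_continuous_in_time:
  fixes g :: "real \<Rightarrow> real \<Rightarrow> real"
  assumes space: "\<And>t. t \<in> I \<Longrightarrow> continuous_on UNIV (g t)"
    and time: "\<And>t e. t \<in> I \<Longrightarrow> e > 0 \<Longrightarrow> \<forall>\<^sub>F \<tau> in at t within I. \<forall>x. \<bar>g \<tau> x - g t x\<bar> \<le> e"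
  shows "continuous_on (I \<times> UNIV) (\<lambda>(t, x). g t x)"
  unfolding continuous_on_iff
proof (intro ballI allI impI)
  fix p e assume p: "p \<in> I \<times> (UNIV :: real set)" and "(0::real) < e"
  obtain t x where tx: "p = (t, x)" "t \<in> I"
    using p by auto
  obtain \<delta> where "\<delta> > 0" and \<delta>: "\<And>\<tau> y. \<tau> \<in> I \<Longrightarrow> \<tau> \<noteq> t \<Longrightarrow> dist \<tau> t < \<delta> \<Longrightarrow> \<bar>g \<tau> y - g t y\<bar> \<le> e / 2"
    using time[OF \<open>t \<in> I\<close>, of "e / 2"] \<open>e > 0\<close> unfolding eventually_at by auto
  obtain \<eta> where "\<eta> > 0" and \<eta>: "\<And>y. dist y x < \<eta> \<Longrightarrow> dist (g t y) (g t x) < e / 2"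
    using space[OF \<open>t \<in> I\<close>] \<open>e > 0\<close> unfolding continuous_on_iff by (metis UNIV_I half_gt_zero)
  show "\<exists>d>0. \<forall>p'\<in>I \<times> UNIV. dist p' p < d \<longrightarrow> dist (case p' of (t, x) \<Rightarrow> g t x) (case p of (t, x) \<Rightarrow> g t x) < e"
  proof (intro exI[of _ "min \<delta> \<eta>"] conjI ballI impI)
    fix p' assume p': "p' \<in> I \<times> (UNIV :: real set)" "dist p' p < min \<delta> \<eta>"
    obtain \<tau> y where ty: "p' = (\<tau>, y)" "\<tau> \<in> I"
      using p' by auto
    have "dist \<tau> t < \<delta>" "dist y x < \<eta>"
      using p'(2) dist_fst_le[of p' p] dist_snd_le[of p' p] by (simp_all add: tx ty)
    then have "\<bar>g \<tau> y - g t y\<bar> \<le> e / 2" "\<bar>g t y - g t x\<bar> < e / 2"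
      using \<delta>[OF \<open>\<tau> \<in> I\<close>] \<eta>[of y] \<open>e > 0\<close> by (cases "\<tau> = t"; simp add: dist_real_def)+
    then show "dist (case p' of (t, x) \<Rightarrow> g t x) (case p of (t, x) \<Rightarrow> g t x) < e"
      unfolding tx ty prod.case dist_real_def by linarith
  qed (use \<open>\<delta> > 0\<close> \<open>\<eta> > 0\<close> in auto)
qed

text \<open>Uniform continuity in time makes a bound at one time valid, up to 1, at nearby times;
the bisection principle for compact intervals gives a common bound.\<close>

lemma bounded_on_compact_time:
  fixes g :: "real \<Rightarrow> real \<Rightarrow> real"
  assumes bounded: "\<And>t. t \<in> {0..} \<Longrightarrow> \<exists>M. \<forall>x. \<bar>g t x\<bar> \<le> M"
    and time: "\<And>t e. t \<in> {0..} \<Longrightarrow> e > 0 \<Longrightarrow> \<forall>\<^sub>F \<tau> in at t within {0..}. \<forall>x. \<bar>g \<tau> x - g t x\<bar> \<le> e"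
    and "S \<ge> 0"
  shows "\<exists>M. \<forall>t\<in>{0..S}. \<forall>x. \<bar>g t x\<bar> \<le> M"
proof -
  have "\<exists>M. \<forall>t\<in>{0..S} \<inter> {0..}. \<forall>x. \<bar>g t x\<bar> \<le> M"
  proof (rule Bolzano[where P = "\<lambda>a b. \<exists>M. \<forall>t\<in>{a..b} \<inter> {0..}. \<forall>x. \<bar>g t x\<bar> \<le> M", OF \<open>S \<ge> 0\<close>])
    fix a b c :: real
    assume "\<exists>M. \<forall>t\<in>{a..b} \<inter> {0..}. \<forall>x. \<bar>g t x\<bar> \<le> M" "\<exists>M. \<forall>t\<in>{b..c} \<inter> {0..}. \<forall>x. \<bar>g t x\<bar> \<le> M"
    then obtain M N where "\<forall>t\<in>{a..b} \<inter> {0..}. \<forall>x. \<bar>g t x\<bar> \<le> M" "\<forall>t\<in>{b..c} \<inter> {0..}. \<forall>x. \<bar>g t x\<bar> \<le> N"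
      by blast
    then have "\<bar>g t x\<bar> \<le> max M N" if "t \<in> {a..c} \<inter> {0..}" for t x
      using that by (cases "t \<le> b") (auto simp: le_max_iff_disj)
    then show "\<exists>M. \<forall>t\<in>{a..c} \<inter> {0..}. \<forall>x. \<bar>g t x\<bar> \<le> M"
      by blast
  next
    fix t :: real
    assume "0 \<le> t"
    then have "t \<in> {0..}"
      by simp
    then obtain M where M: "\<bar>g t x\<bar> \<le> M" for x
      using bounded by blast
    obtain \<delta> where "\<delta> > 0" and \<delta>: "\<And>\<tau> y. \<tau> \<in> {0..} \<Longrightarrow> \<tau> \<noteq> t \<Longrightarrow> dist \<tau> t < \<delta> \<Longrightarrow> \<bar>g \<tau> y - g t y\<bar> \<le> 1"
      using time[OF \<open>t \<in> {0..}\<close>, of 1] unfolding eventually_at by auto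
    have "\<bar>g \<tau> y\<bar> \<le> M + 1" if "\<tau> \<in> {0..}" "dist \<tau> t < \<delta>" for \<tau> y
      using \<delta>[of \<tau> y] that M[of y] by (cases "\<tau> = t") force+
    then show "\<exists>\<delta>>0. \<forall>a b. a \<le> t \<and> t \<le> b \<and> b - a < \<delta> \<longrightarrow> (\<exists>M. \<forall>t\<in>{a..b} \<inter> {0..}. \<forall>x. \<bar>g t x\<bar> \<le> M)"
      using \<open>\<delta> > 0\<close> by (intro exI[of _ \<delta>] conjI allI impI exI[of _ "M + 1"] ballI) (auto simp: dist_real_def)
  qed
  then show ?thesis
    by auto
qed

text \<open>Dominated convergence; the kernel in the variable \<open>z\<close> does not move with the point \<open>q t\<close>.\<close>

lemma continuous_on_left_average:
  fixes f :: "real \<Rightarrow> real \<Rightarrow> real"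
  assumes "c > 0"
    and space: "\<And>t. t \<in> I \<Longrightarrow> continuous_on UNIV (f t)"
    and cont: "\<And>z. continuous_on I (\<lambda>t. f t (q t - z))"
    and B: "\<And>t x. t \<in> I \<Longrightarrow> \<bar>f t x\<bar> \<le> B"
  shows "continuous_on I (\<lambda>t. left_average c (f t) (q t))"
  unfolding continuous_on_sequentially
proof (intro allI ballI impI)
  fix r t assume t: "t \<in> I" and r: "(\<forall>n. r n \<in> I) \<and> r \<longlonglongrightarrow> t"
  have "(\<lambda>n. LINT z|lborel. indicator {0..} z * exp (- z / c) * f (r n) (q (r n) - z))
      \<longlonglongrightarrow> (LINT z|lborel. indicator {0..} z * exp (- z / c) * f t (q t - z))"
  proof (rule integral_dominated_convergence[where w = "\<lambda>z. B * (indicator {0..} z * exp (- z / c))"])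
    have meas: "(\<lambda>z. indicator {0..} z * exp (- z / c) * f u (q u - z)) \<in> borel_measurable lborel" if "u \<in> I" for u
    proof -
      have [measurable]: "f u \<in> borel_measurable borel"
        using space[OF that] by (rule borel_measurable_continuous_onI)
      show ?thesis
        by measurable
    qed
    show "(\<lambda>z. indicator {0..} z * exp (- z / c) * f t (q t - z)) \<in> borel_measurable lborel"
      by (rule meas[OF t])
    show "(\<lambda>z. indicator {0..} z * exp (- z / c) * f (r n) (q (r n) - z)) \<in> borel_measurable lborel" for n
      using r by (intro meas) simp
    show "integrable lborel (\<lambda>z. B * (indicator {0..} z * exp (- z / c)))"
      by (intro integrable_mult_right integrable_exp_decay[OF \<open>c > 0\<close>])
    show "AE z in lborel. (\<lambda>n. indicator {0..} z * exp (- z / c) * f (r n) (q (r n) - z))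
        \<longlonglongrightarrow> indicator {0..} z * exp (- z / c) * f t (q t - z)"
    proof (rule AE_I2)
      fix z
      have "(\<lambda>n. f (r n) (q (r n) - z)) \<longlonglongrightarrow> f t (q t - z)"
        using cont[of z] t r unfolding continuous_on_sequentially comp_def by blast
      then show "(\<lambda>n. indicator {0..} z * exp (- z / c) * f (r n) (q (r n) - z))
          \<longlonglongrightarrow> indicator {0..} z * exp (- z / c) * f t (q t - z)"
        by (rule tendsto_mult_left)
    qed
    show "AE z in lborel. norm (indicator {0..} z * exp (- z / c) * f (r n) (q (r n) - z)) \<le> B * (indicator {0..} z * exp (- z / c))" for n
    proof (rule AE_I2)
      fix z
      have "indicator {0..} z * exp (- z / c) * \<bar>f (r n) (q (r n) - z)\<bar> \<le> indicator {0..} z * exp (- z / c) * B"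
        using r by (intro mult_left_mono B) simp_all
      then show "norm (indicator {0..} z * exp (- z / c) * f (r n) (q (r n) - z)) \<le> B * (indicator {0..} z * exp (- z / c))"
        by (simp add: abs_mult mult_ac)
    qed
  qed
  then show "((\<lambda>t. left_average c (f t) (q t)) \<circ> r) \<longlonglongrightarrow> left_average c (f t) (q t)"
    unfolding comp_def left_average_def using \<open>c > 0\<close> by (intro tendsto_divide tendsto_const) simp_all
qed

lemma continuous_on_right_average:
  fixes f :: "real \<Rightarrow> real \<Rightarrow> real"
  assumes "c > 0"
    and space: "\<And>t. t \<in> I \<Longrightarrow> continuous_on UNIV (f t)"
    and cont: "\<And>z. continuous_on I (\<lambda>t. f t (q t + z))"
    and B: "\<And>t x. t \<in> I \<Longrightarrow> \<bar>f t x\<bar> \<le> B"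
  shows "continuous_on I (\<lambda>t. right_average c (f t) (q t))"
  unfolding right_average_reflect
proof (rule continuous_on_left_average[OF \<open>c > 0\<close>, where B = B])
  show "continuous_on UNIV (\<lambda>y. f t (- y))" if "t \<in> I" for t
    using space[OF that] by (rule continuous_on_compose2) (auto intro!: continuous_intros)
  show "continuous_on I (\<lambda>t. f t (- (- q t - z)))" for z
    using cont[of z] by (simp add: add.commute)
qed (use B in auto)

section \<open>Wave breaking along a characteristic\<close>

definition quadratic_source :: "real \<Rightarrow> (real \<Rightarrow> real) \<Rightarrow> (real \<Rightarrow> real) \<Rightarrow> real \<Rightarrow> real" where
  "quadratic_source c u u' y = c\<^sup>2 * (u y)\<^sup>2 + (c\<^sup>2)\<^sup>2 / 2 * (u' y)\<^sup>2"

text \<open>Minus the space derivative of the resolvent applied to the source.\<close>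

definition nonlocal_force :: "real \<Rightarrow> (real \<Rightarrow> real) \<Rightarrow> (real \<Rightarrow> real) \<Rightarrow> real \<Rightarrow> real" where
  "nonlocal_force c u u' x =
     (left_average c (quadratic_source c u u') x - right_average c (quadratic_source c u u') x) / c"

text \<open>What a strong solution on \<open>[0, \<infinity>)\<close> provides pointwise. All statements about time are uniform in
\<open>x\<close>, which is what allows moving points to be inserted for \<open>x\<close>.\<close>

locale classical_solution =
  fixes c :: real and v vx :: "real \<Rightarrow> real \<Rightarrow> real"
  assumes c_pos: "c > 0"
    and space_deriv: "\<And>t x. t \<ge> 0 \<Longrightarrow> (v t has_real_derivative vx t x) (at x)"
    and vx_cont: "\<And>t. t \<ge> 0 \<Longrightarrow> continuous_on UNIV (vx t)"
    and v_bounded: "\<And>t. t \<ge> 0 \<Longrightarrow> \<exists>M. \<forall>x. \<bar>v t x\<bar> \<le> M"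
    and vx_bounded: "\<And>t. t \<ge> 0 \<Longrightarrow> \<exists>M. \<forall>x. \<bar>vx t x\<bar> \<le> M"
    and v_time: "\<And>t e. t \<ge> 0 \<Longrightarrow> e > 0 \<Longrightarrow> \<forall>\<^sub>F \<tau> in at t within {0..}. \<forall>x. \<bar>v \<tau> x - v t x\<bar> \<le> e"
    and vx_time: "\<And>t e. t \<ge> 0 \<Longrightarrow> e > 0 \<Longrightarrow> \<forall>\<^sub>F \<tau> in at t within {0..}. \<forall>x. \<bar>vx \<tau> x - vx t x\<bar> \<le> e"
    and evolution: "\<And>t e. t \<ge> 0 \<Longrightarrow> e > 0 \<Longrightarrow> \<forall>\<^sub>F \<tau> in at t within {0..}. \<forall>x.
      \<bar>(v \<tau> x - v t x) / (\<tau> - t) - (nonlocal_force c (v t) (vx t) x - c\<^sup>2 * v t x * vx t x)\<bar> \<le> e"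
begin

abbreviation source :: "real \<Rightarrow> real \<Rightarrow> real" where
  "source t \<equiv> quadratic_source c (v t) (vx t)"

abbreviation force :: "real \<Rightarrow> real \<Rightarrow> real" where
  "force t \<equiv> nonlocal_force c (v t) (vx t)"

lemma v_cont: "t \<ge> 0 \<Longrightarrow> continuous_on UNIV (v t)"
  by (rule DERIV_continuous_on[where D = "vx t"]) (simp add: space_deriv has_field_derivative_at_within)

lemma source_cont: "t \<ge> 0 \<Longrightarrow> continuous_on UNIV (source t)"
  unfolding quadratic_source_def by (intro continuous_intros v_cont vx_cont)

lemma source_le:
  assumes "\<And>x. \<bar>v t x\<bar> \<le> M" "\<And>x. \<bar>vx t x\<bar> \<le> M"
  shows "\<bar>source t x\<bar> \<le> c\<^sup>2 * M\<^sup>2 + (c\<^sup>2)\<^sup>2 / 2 * M\<^sup>2"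
proof -
  have "(v t x)\<^sup>2 \<le> M\<^sup>2" "(vx t x)\<^sup>2 \<le> M\<^sup>2"
    using assms[of x] by (simp_all add: abs_le_square_iff[symmetric])
  then show ?thesis
    unfolding quadratic_source_def by (simp add: add_mono mult_left_mono)
qed

lemma bounded_on_compact:
  assumes "S \<ge> 0"
  obtains M where "M \<ge> 0" "\<And>t x. t \<in> {0..S} \<Longrightarrow> \<bar>v t x\<bar> \<le> M" "\<And>t x. t \<in> {0..S} \<Longrightarrow> \<bar>vx t x\<bar> \<le> M"
proof -
  obtain M1 where M1: "\<forall>t\<in>{0..S}. \<forall>x. \<bar>v t x\<bar> \<le> M1"
    using bounded_on_compact_time[OF _ _ \<open>S \<ge> 0\<close>, of v] v_bounded v_time by auto
  obtain M2 where M2: "\<forall>t\<in>{0..S}. \<forall>x. \<bar>vx t x\<bar> \<le> M2"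
    using bounded_on_compact_time[OF _ _ \<open>S \<ge> 0\<close>, of vx] vx_bounded vx_time by auto
  show thesis
  proof (rule that[of "max 0 (max M1 M2)"])
    show "\<bar>v t x\<bar> \<le> max 0 (max M1 M2)" "\<bar>vx t x\<bar> \<le> max 0 (max M1 M2)" if "t \<in> {0..S}" for t x
      using M1 M2 that by (auto simp: le_max_iff_disj)
  qed simp
qed

lemma source_bounded:
  assumes "t \<ge> 0"
  obtains B where "\<And>x. \<bar>source t x\<bar> \<le> B"
proof -
  obtain M where "\<And>x. \<bar>v t x\<bar> \<le> M" "\<And>x. \<bar>vx t x\<bar> \<le> M"
    using bounded_on_compact[OF assms] assms by (metis atLeastAtMost_iff order_refl)
  then show thesis
    using source_le that by blast
qed

lemma left_deriv:
  assumes "t \<ge> 0"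
  shows "(left_average c (source t) has_real_derivative source t x / (2 * c) - left_average c (source t) x / c) (at x)"
proof -
  obtain B where "\<And>x. \<bar>source t x\<bar> \<le> B"
    using source_bounded[OF assms] by blast
  then show ?thesis
    by (rule left_average_has_derivative[OF c_pos source_cont[OF assms]])
qed

lemma right_deriv:
  assumes "t \<ge> 0"
  shows "(right_average c (source t) has_real_derivative right_average c (source t) x / c - source t x / (2 * c)) (at x)"
proof -
  obtain B where "\<And>x. \<bar>source t x\<bar> \<le> B"
    using source_bounded[OF assms] by blast
  then show ?thesis
    by (rule right_average_has_derivative[OF c_pos source_cont[OF assms]])
qed

text \<open>The resolvent identity \<open>\<partial>\<^sub>x\<^sup>2 P = (P - f) / c\<^sup>2\<close> with \<open>P = (1 - c\<^sup>2 \<partial>\<^sub>x\<^sup>2)\<^sup>-\<^sup>1 f\<close>: two space derivatives of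
\<open>P\<close> cost none of \<open>f\<close>.\<close>

definition force_deriv :: "real \<Rightarrow> real \<Rightarrow> real" where
  "force_deriv t x = (source t x - (left_average c (source t) x + right_average c (source t) x)) / c\<^sup>2"

lemma force_has_deriv:
  assumes "t \<ge> 0"
  shows "(force t has_real_derivative force_deriv t x) (at x)"
  unfolding nonlocal_force_def[abs_def] force_deriv_def using c_pos
  by (auto intro!: derivative_eq_intros left_deriv[OF assms] right_deriv[OF assms] simp: field_simps power2_eq_square)

lemma force_cont: "t \<ge> 0 \<Longrightarrow> continuous_on UNIV (force t)"
  by (rule DERIV_continuous_on[where D = "force_deriv t"]) (simp add: force_has_deriv has_field_derivative_at_within)

lemma continuous_along:
  assumes "continuous_on I p" "I \<subseteq> {0..}"
  shows "continuous_on I (\<lambda>t. v t (p t))" "continuous_on I (\<lambda>t. vx t (p t))" "continuous_on I (\<lambda>t. source t (p t))"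
proof -
  have along: "continuous_on I (\<lambda>t. g t (p t))"
    if "continuous_on ({0..} \<times> UNIV) (\<lambda>(t, x). g t x)" for g :: "real \<Rightarrow> real \<Rightarrow> real"
  proof -
    have "continuous_on I (\<lambda>t. case (t, p t) of (t, x) \<Rightarrow> g t x)"
      by (rule continuous_on_compose2[OF that]) (use assms in \<open>auto intro!: continuous_intros\<close>)
    then show ?thesis
      by simp
  qed
  show v: "continuous_on I (\<lambda>t. v t (p t))"
    by (rule along, rule continuous_on_of_uniformly_continuous_in_time) (auto intro: v_cont v_time)
  show vx: "continuous_on I (\<lambda>t. vx t (p t))"
    by (rule along, rule continuous_on_of_uniformly_continuous_in_time) (auto intro: vx_cont vx_time)
  show "continuous_on I (\<lambda>t. source t (p t))"
    unfolding quadratic_source_def by (intro continuous_intros v vx)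
qed

text \<open>The velocity \<open>v\<close> is Lipschitz in \<open>x\<close> only with a constant depending on the time interval, so it is
frozen outside \<open>[0, S]\<close> before the global existence theorem is applied.\<close>

lemma characteristic:
  assumes "S \<ge> 0"
  obtains q where "q 0 = x0" "\<And>t. t \<in> {0..S} \<Longrightarrow> (q has_real_derivative c\<^sup>2 * v t (q t)) (at t within {0..})"
proof -
  obtain M where M: "M \<ge> 0" "\<And>t x. t \<in> {0..S} \<Longrightarrow> \<bar>v t x\<bar> \<le> M" "\<And>t x. t \<in> {0..S} \<Longrightarrow> \<bar>vx t x\<bar> \<le> M"
    using bounded_on_compact[OF assms] by blast
  \<comment> \<open>the projection of the time axis onto \<open>[0, S]\<close>\<close>
  define k where "k = (\<lambda>t. max 0 (min S t))"
  have k: "k t \<in> {0..S}" for t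
    using assms by (auto simp: k_def)
  define b where "b = (\<lambda>t x. c\<^sup>2 * v (k t) x)"
  obtain q where q: "q 0 = x0" "\<And>t. t \<ge> 0 \<Longrightarrow> (q has_real_derivative b t (q t)) (at t within {0..})"
  proof (rule global_lipschitz_flow[of b "c\<^sup>2 * M" "c\<^sup>2 * (M + 1)" x0])
    have "continuous_on ({0..} \<times> UNIV) (\<lambda>(t, x). v t x)"
      by (rule continuous_on_of_uniformly_continuous_in_time) (auto intro: v_cont v_time)
    moreover have "continuous_on UNIV (\<lambda>p. (k (fst p), snd p :: real))"
      unfolding k_def by (intro continuous_intros)
    moreover have "(\<lambda>p. (k (fst p), snd p :: real)) ` UNIV \<subseteq> {0..} \<times> UNIV"
      using k by auto
    ultimately have "continuous_on UNIV (\<lambda>p. case (k (fst p), snd p) of (t, x) \<Rightarrow> v t x)"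
      by (rule continuous_on_compose2)
    then show "continuous_on UNIV (\<lambda>(t, x). b t x)"
      unfolding b_def case_prod_unfold fst_conv snd_conv by (intro continuous_intros)
    show "\<bar>b t x\<bar> \<le> c\<^sup>2 * M" for t x
      using M(2)[OF k, of t x] by (simp add: b_def abs_mult mult_left_mono)
    show "\<bar>b t x - b t y\<bar> \<le> c\<^sup>2 * (M + 1) * \<bar>x - y\<bar>" for t x y
    proof -
      have "norm (v (k t) x - v (k t) y) \<le> M * norm (x - y)"
      proof (rule field_differentiable_bound[of UNIV "v (k t)" "vx (k t)"])
        show "(v (k t) has_field_derivative vx (k t) z) (at z within UNIV)" for z
          using space_deriv[of "k t" z] k[of t] by simp
        show "norm (vx (k t) z) \<le> M" for z
          using M(3)[OF k] by simp
      qed simp_all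
      also have "\<dots> \<le> (M + 1) * norm (x - y)"
        by (intro mult_right_mono) simp_all
      finally have "c\<^sup>2 * \<bar>v (k t) x - v (k t) y\<bar> \<le> c\<^sup>2 * ((M + 1) * \<bar>x - y\<bar>)"
        by (intro mult_left_mono) simp_all
      then show ?thesis
        by (simp add: b_def abs_mult mult.assoc flip: right_diff_distrib)
    qed
    show "0 < c\<^sup>2 * (M + 1)"
      using c_pos M(1) by simp
  qed blast
  show thesis
  proof (rule that[of q])
    show "q 0 = x0"
      by (rule q(1))
    show "(q has_real_derivative c\<^sup>2 * v t (q t)) (at t within {0..})" if "t \<in> {0..S}" for t
      using q(2)[of t] that by (auto simp: b_def k_def min_def max_def split: if_splits)
  qed
qed

text \<open>The increment of \<open>v\<close> along \<open>p\<close> is split into a time increment at the moving point \<open>p \<tau>\<close>, where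
the evolution equation holds uniformly in \<open>x\<close>, and a space increment at the fixed time \<open>t\<close>, where
the ordinary chain rule applies.\<close>

lemma transport_derivative:
  assumes t: "t \<ge> 0" and p: "(p has_real_derivative p') (at t within {0..})"
  shows "((\<lambda>\<tau>. v \<tau> (p \<tau>)) has_real_derivative
      force t (p t) - c\<^sup>2 * v t (p t) * vx t (p t) + vx t (p t) * p') (at t within {0..})"
proof -
  let ?W = "\<lambda>x. force t x - c\<^sup>2 * v t x * vx t x"
  have "((\<lambda>\<tau>. (v \<tau> (p \<tau>) - v t (p \<tau>)) / (\<tau> - t) - ?W (p \<tau>)) \<longlongrightarrow> 0) (at t within {0..})"
  proof (rule tendstoI)
    fix e :: real assume "e > 0"
    then have "\<forall>\<^sub>F \<tau> in at t within {0..}. \<forall>x. \<bar>(v \<tau> x - v t x) / (\<tau> - t) - ?W x\<bar> \<le> e / 2"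
      by (intro evolution[OF t]) simp
    then show "\<forall>\<^sub>F \<tau> in at t within {0..}. dist ((v \<tau> (p \<tau>) - v t (p \<tau>)) / (\<tau> - t) - ?W (p \<tau>)) 0 < e"
    proof eventually_elim
      case (elim \<tau>)
      then have "\<bar>(v \<tau> (p \<tau>) - v t (p \<tau>)) / (\<tau> - t) - ?W (p \<tau>)\<bar> \<le> e / 2"
        by (rule spec)
      then show ?case
        using \<open>e > 0\<close> unfolding dist_real_def diff_0_right by linarith
    qed
  qed
  moreover have "((\<lambda>\<tau>. ?W (p \<tau>)) \<longlongrightarrow> ?W (p t)) (at t within {0..})"
  proof (rule isCont_tendsto_compose[where g = ?W])
    have "continuous_on UNIV ?W"
      by (intro continuous_intros force_cont v_cont vx_cont t)
    then show "isCont ?W (p t)"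
      by (simp add: continuous_on_eq_continuous_at)
    show "(p \<longlongrightarrow> p t) (at t within {0..})"
      using DERIV_continuous[OF p] by (simp add: continuous_within)
  qed
  ultimately have "((\<lambda>\<tau>. (v \<tau> (p \<tau>) - v t (p \<tau>)) / (\<tau> - t) - ?W (p \<tau>) + ?W (p \<tau>)) \<longlongrightarrow> 0 + ?W (p t)) (at t within {0..})"
    by (rule tendsto_add)
  moreover have "((\<lambda>\<tau>. v t (p \<tau>)) has_real_derivative vx t (p t) * p') (at t within {0..})"
    by (rule DERIV_chain2[where f = "v t", OF space_deriv[OF t] p])
  then have "((\<lambda>\<tau>. (v t (p \<tau>) - v t (p t)) / (\<tau> - t)) \<longlongrightarrow> vx t (p t) * p') (at t within {0..})"
    by (simp add: has_field_derivative_iff)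
  ultimately have "((\<lambda>\<tau>. ((v \<tau> (p \<tau>) - v t (p \<tau>)) / (\<tau> - t) - ?W (p \<tau>) + ?W (p \<tau>)) + (v t (p \<tau>) - v t (p t)) / (\<tau> - t))
      \<longlongrightarrow> 0 + ?W (p t) + vx t (p t) * p') (at t within {0..})"
    by (rule tendsto_add)
  then show ?thesis
    by (simp add: has_field_derivative_iff diff_divide_distrib)
qed

lemma force_deriv_bounded:
  assumes "S \<ge> 0"
  obtains F where "\<And>t x. t \<in> {0..S} \<Longrightarrow> \<bar>force_deriv t x\<bar> \<le> F"
proof -
  obtain M where M: "M \<ge> 0" "\<And>t x. t \<in> {0..S} \<Longrightarrow> \<bar>v t x\<bar> \<le> M" "\<And>t x. t \<in> {0..S} \<Longrightarrow> \<bar>vx t x\<bar> \<le> M"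
    using bounded_on_compact[OF assms] by blast
  define B where "B = c\<^sup>2 * M\<^sup>2 + (c\<^sup>2)\<^sup>2 / 2 * M\<^sup>2"
  define K where "K = left_average c (\<lambda>_. 1) 0"
  have "\<bar>force_deriv t x\<bar> \<le> (B + (B * K + B * K)) / c\<^sup>2" if t: "t \<in> {0..S}" for t x
  proof -
    have src: "\<bar>source t y\<bar> \<le> B" for y
      unfolding B_def by (rule source_le) (use M t in auto)
    have cont: "continuous_on UNIV (source t)"
      using t by (intro source_cont) simp
    have "\<bar>left_average c (source t) x\<bar> \<le> B * K"
      unfolding K_def by (rule left_average_bounded[OF c_pos borel_measurable_continuous_onI[OF cont] src])
    moreover have "\<bar>right_average c (source t) x\<bar> \<le> B * K"
      unfolding K_def right_average_reflect
    proof (rule left_average_bounded[OF c_pos])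
      show "(\<lambda>y. source t (- y)) \<in> borel_measurable borel"
        by (intro borel_measurable_continuous_onI continuous_on_compose2[OF cont] continuous_intros) auto
      show "\<bar>source t (- y)\<bar> \<le> B" for y
        by (rule src)
    qed
    ultimately have "\<bar>source t x - (left_average c (source t) x + right_average c (source t) x)\<bar> \<le> B + (B * K + B * K)"
      using src[of x] by linarith
    then show ?thesis
      unfolding force_deriv_def using c_pos by (simp add: abs_divide divide_right_mono)
  qed
  then show thesis
    by (rule that)
qed

lemma force_deriv_cont_along:
  assumes q: "continuous_on {0..S} q" and "S \<ge> 0"
  shows "continuous_on {0..S} (\<lambda>t. force_deriv t (q t))"
proof -
  obtain M where M: "M \<ge> 0" "\<And>t x. t \<in> {0..S} \<Longrightarrow> \<bar>v t x\<bar> \<le> M" "\<And>t x. t \<in> {0..S} \<Longrightarrow> \<bar>vx t x\<bar> \<le> M"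
    using bounded_on_compact[OF \<open>S \<ge> 0\<close>] by blast
  have src: "\<bar>source t x\<bar> \<le> c\<^sup>2 * M\<^sup>2 + (c\<^sup>2)\<^sup>2 / 2 * M\<^sup>2" if "t \<in> {0..S}" for t x
    by (rule source_le) (use M that in auto)
  have "continuous_on {0..S} (\<lambda>t. left_average c (source t) (q t))"
    by (rule continuous_on_left_average[OF c_pos _ _ src])
       (auto intro!: source_cont continuous_along continuous_intros q)
  moreover have "continuous_on {0..S} (\<lambda>t. right_average c (source t) (q t))"
    by (rule continuous_on_right_average[OF c_pos _ _ src])
       (auto intro!: source_cont continuous_along continuous_intros q)
  moreover have "continuous_on {0..S} (\<lambda>t. source t (q t))"
    by (rule continuous_along(3)[OF q]) auto
  ultimately show ?thesis
    unfolding force_deriv_def using c_pos by (intro continuous_intros) auto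
qed

text \<open>The equation of the slope, without second space derivatives of \<open>v\<close>. For a fixed shift \<open>h\<close> the
quotient \<open>\<mu> = (v t (q + h) - v t q) / h\<close> is differentiable in time; in its derivative the transport
terms at \<open>q\<close> cancel and those at \<open>q + h\<close> combine to \<open>- c\<^sup>2 * \<mu> * vx t (q + h)\<close>, while the force contributes
its own difference quotient. All terms are bounded by the mean value theorem, so the integrated
equation passes to the limit \<open>h \<rightarrow> 0\<close> by dominated convergence; the limit of the right-hand side is
continuous in time, so the integrated equation can be differentiated again.\<close>

lemma slope_along_characteristic:
  assumes "S \<ge> 0"
    and q: "\<And>t. t \<in> {0..S} \<Longrightarrow> (q has_real_derivative c\<^sup>2 * v t (q t)) (at t within {0..})"
    and T: "T \<in> {0..S}"
  shows "((\<lambda>t. vx t (q t)) has_real_derivative force_deriv T (q T) - c\<^sup>2 * (vx T (q T))\<^sup>2) (at T within {0..S})"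
proof -
  obtain M where M: "M \<ge> 0" "\<And>t x. t \<in> {0..S} \<Longrightarrow> \<bar>v t x\<bar> \<le> M" "\<And>t x. t \<in> {0..S} \<Longrightarrow> \<bar>vx t x\<bar> \<le> M"
    using bounded_on_compact[OF \<open>S \<ge> 0\<close>] by blast
  obtain F where F: "\<And>t x. t \<in> {0..S} \<Longrightarrow> \<bar>force_deriv t x\<bar> \<le> F"
    using force_deriv_bounded[OF \<open>S \<ge> 0\<close>] by blast
  have sub: "{0..S} \<subseteq> {0..}"
    by auto
  have q_cont: "continuous_on {0..S} q"
    using DERIV_subset[OF q sub] by (rule DERIV_continuous_on)
  define h where "h = (\<lambda>n. 1 / real (Suc n))"
  have h_pos: "h n > 0" for n
    by (simp add: h_def)
  have "h \<longlonglongrightarrow> 0"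
    unfolding h_def using LIMSEQ_inverse_real_of_nat by (simp add: inverse_eq_divide)
  then have h_lim: "filterlim h (at 0) sequentially"
    using h_pos by (auto simp: filterlim_at less_imp_neq[symmetric])
  define \<mu> where "\<mu> = (\<lambda>n t. (v t (q t + h n) - v t (q t)) / h n)"
  define \<phi> where "\<phi> = (\<lambda>n t. (force t (q t + h n) - force t (q t)) / h n)"
  define R where "R = (\<lambda>n t. \<phi> n t - c\<^sup>2 * \<mu> n t * vx t (q t + h n))"
  define Rlim where "Rlim = (\<lambda>t. force_deriv t (q t) - c\<^sup>2 * (vx t (q t))\<^sup>2)"
  have quotient_bound: "\<bar>(g (x + h n) - g x) / h n\<bar> \<le> B"
    if g: "\<And>y. (g has_real_derivative g' y) (at y)" and B: "\<And>y. \<bar>g' y\<bar> \<le> B" for g g' :: "real \<Rightarrow> real" and B x n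
  proof -
    have "norm (g (x + h n) - g x) \<le> B * norm (x + h n - x)"
      by (rule field_differentiable_bound[of UNIV g g']) (use g B in auto)
    then show ?thesis
      using h_pos[of n] by (simp add: abs_divide pos_divide_le_eq)
  qed
  have quotient_lim: "(\<lambda>n. (g (x + h n) - g x) / h n) \<longlonglongrightarrow> D"
    if "(g has_real_derivative D) (at x)" for g :: "real \<Rightarrow> real" and x D
    using filterlim_compose[OF that[unfolded DERIV_def] h_lim] .
  have \<mu>_deriv: "(\<mu> n has_real_derivative R n t) (at t within {0..S})" if t: "t \<in> {0..S}" for n t
  proof -
    have "t \<ge> 0"
      using t by simp
    have q': "((\<lambda>t. q t + h n) has_real_derivative c\<^sup>2 * v t (q t)) (at t within {0..})"
      using DERIV_add[OF q[OF t] DERIV_const[of "h n"]] by simp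
    note D = DERIV_cdivide[OF DERIV_diff[OF transport_derivative[OF \<open>t \<ge> 0\<close> q'] transport_derivative[OF \<open>t \<ge> 0\<close> q[OF t]]], of "h n"]
    have "R n t = (force t (q t + h n) - c\<^sup>2 * v t (q t + h n) * vx t (q t + h n) + vx t (q t + h n) * (c\<^sup>2 * v t (q t))
        - (force t (q t) - c\<^sup>2 * v t (q t) * vx t (q t) + vx t (q t) * (c\<^sup>2 * v t (q t)))) / h n"
      unfolding R_def \<phi>_def \<mu>_def using h_pos[of n] by (simp add: field_simps)
    then show ?thesis
      unfolding \<mu>_def using DERIV_subset[OF D sub] by simp
  qed
  have R_bound: "\<bar>R n t\<bar> \<le> F + c\<^sup>2 * M * M" if t: "t \<in> {0..S}" for n t
  proof -
    have "t \<ge> 0"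
      using t by simp
    have "\<bar>\<phi> n t\<bar> \<le> F"
      unfolding \<phi>_def by (rule quotient_bound[OF force_has_deriv[OF \<open>t \<ge> 0\<close>] F[OF t]])
    moreover have "\<bar>\<mu> n t\<bar> \<le> M"
      unfolding \<mu>_def by (rule quotient_bound[OF space_deriv[OF \<open>t \<ge> 0\<close>] M(3)[OF t]])
    then have "c\<^sup>2 * \<bar>\<mu> n t\<bar> * \<bar>vx t (q t + h n)\<bar> \<le> c\<^sup>2 * M * M"
      using M(1) by (intro mult_mono mult_nonneg_nonneg M(3)[OF t]) auto
    then have "\<bar>c\<^sup>2 * \<mu> n t * vx t (q t + h n)\<bar> \<le> c\<^sup>2 * M * M"
      by (simp add: abs_mult)
    ultimately show ?thesis
      unfolding R_def by linarith
  qed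
  have \<mu>_lim: "(\<lambda>n. \<mu> n t) \<longlonglongrightarrow> vx t (q t)" if t: "t \<in> {0..S}" for t
    unfolding \<mu>_def by (rule quotient_lim, rule space_deriv) (use t in simp)
  have R_lim: "(\<lambda>n. R n t) \<longlonglongrightarrow> Rlim t" if t: "t \<in> {0..S}" for t
  proof -
    have "t \<ge> 0"
      using t by simp
    have "(\<lambda>n. \<phi> n t) \<longlonglongrightarrow> force_deriv t (q t)"
      unfolding \<phi>_def by (rule quotient_lim[OF force_has_deriv[OF \<open>t \<ge> 0\<close>]])
    moreover have "(\<lambda>n. vx t (q t + h n)) \<longlonglongrightarrow> vx t (q t)"
    proof (rule isCont_tendsto_compose[where g = "vx t"])
      show "isCont (vx t) (q t)"
        using vx_cont[OF \<open>t \<ge> 0\<close>] by (simp add: continuous_on_eq_continuous_at)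
      show "(\<lambda>n. q t + h n) \<longlonglongrightarrow> q t"
        using tendsto_add[OF tendsto_const[of "q t"] \<open>h \<longlonglongrightarrow> 0\<close>] by simp
    qed
    ultimately have "(\<lambda>n. R n t) \<longlonglongrightarrow> force_deriv t (q t) - c\<^sup>2 * vx t (q t) * vx t (q t)"
      unfolding R_def by (intro tendsto_intros \<mu>_lim[OF t])
    then show ?thesis
      by (simp add: Rlim_def power2_eq_square mult.assoc)
  qed
  have integral_eq: "vx t (q t) = vx 0 (q 0) + integral {0..t} Rlim" if t: "t \<in> {0..S}" for t
  proof -
    have R_int: "(R n has_integral \<mu> n t - \<mu> n 0) {0..t}" for n
    proof (rule fundamental_theorem_of_calculus)
      fix u assume "u \<in> {0..t}"
      then have "(\<mu> n has_real_derivative R n u) (at u within {0..t})"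
        using t by (intro DERIV_subset[OF \<mu>_deriv]) auto
      then show "(\<mu> n has_vector_derivative R n u) (at u within {0..t})"
        by (simp add: has_real_derivative_iff_has_vector_derivative)
    qed (use t in simp)
    have "(\<lambda>n. integral {0..t} (R n)) \<longlonglongrightarrow> integral {0..t} Rlim"
      by (rule dominated_convergence(2)[where h = "\<lambda>_. F + c\<^sup>2 * M * M"])
         (use R_int R_bound R_lim t in \<open>auto simp: has_integral_iff\<close>)
    moreover have "integral {0..t} (R n) = \<mu> n t - \<mu> n 0" for n
      using R_int by (rule integral_unique)
    ultimately have "(\<lambda>n. \<mu> n t - \<mu> n 0) \<longlonglongrightarrow> integral {0..t} Rlim"
      by simp
    moreover have "(\<lambda>n. \<mu> n t - \<mu> n 0) \<longlonglongrightarrow> vx t (q t) - vx 0 (q 0)"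
      using \<open>S \<ge> 0\<close> by (intro tendsto_diff \<mu>_lim t) simp
    ultimately have "integral {0..t} Rlim = vx t (q t) - vx 0 (q 0)"
      by (rule LIMSEQ_unique)
    then show ?thesis
      by simp
  qed
  have "continuous_on {0..S} Rlim"
    unfolding Rlim_def
    by (intro continuous_intros force_deriv_cont_along q_cont \<open>S \<ge> 0\<close> continuous_along sub)
  then have "((\<lambda>t. integral {0..t} Rlim) has_real_derivative Rlim T) (at T within {0..S})"
    by (rule integral_has_real_derivative) (use T in simp)
  then have "((\<lambda>t. vx 0 (q 0) + integral {0..t} Rlim) has_real_derivative 0 + Rlim T) (at T within {0..S})"
    by (rule DERIV_add[OF DERIV_const])
  then have "((\<lambda>t. vx t (q t)) has_real_derivative 0 + Rlim T) (at T within {0..S})"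
  proof (rule has_field_derivative_transform_within[where d = 1])
    show "vx 0 (q 0) + integral {0..t} Rlim = vx t (q t)" if "t \<in> {0..S}" for t
      by (rule integral_eq[OF that, symmetric])
  qed (use T in simp_all)
  then show ?thesis
    by (simp add: Rlim_def)
qed

text \<open>On the characteristic from \<open>x0\<close> the quantities \<open>V / c - m\<close> and \<open>- V / c - m\<close>, where \<open>V\<close> is the value
and \<open>m\<close> the slope, reinforce each other, since their product is \<open>m\<^sup>2 - V\<^sup>2 / c\<^sup>2\<close>. The time \<open>S\<close> is
the one by which they would have to blow up.\<close>

lemma no_global_solution:
  "\<not> vx 0 x0 < - (1 / c) * \<bar>v 0 x0\<bar>"
proof
  assume steep: "vx 0 x0 < - (1 / c) * \<bar>v 0 x0\<bar>"
  have steep': "\<bar>v 0 x0\<bar> / c < - vx 0 x0"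
    using steep by simp
  have "v 0 x0 / c \<le> \<bar>v 0 x0\<bar> / c" "- v 0 x0 / c \<le> \<bar>v 0 x0\<bar> / c"
    by (rule divide_right_mono[OF abs_ge_self less_imp_le[OF c_pos]],
        rule divide_right_mono[OF abs_ge_minus_self less_imp_le[OF c_pos]])
  with steep' have pos: "v 0 x0 / c - vx 0 x0 > 0" "- v 0 x0 / c - vx 0 x0 > 0"
    by linarith+
  define k where "k = c\<^sup>2 / 2"
  have "k > 0"
    using c_pos by (simp add: k_def)
  define S where "S = (1 / (v 0 x0 / c - vx 0 x0) + 1 / (- v 0 x0 / c - vx 0 x0)) / (2 * k)"
  have "S \<ge> 0"
    unfolding S_def using pos \<open>k > 0\<close> by (intro divide_nonneg_pos add_nonneg_nonneg) simp_all
  obtain q where q0: "q 0 = x0"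
    and q: "\<And>t. t \<in> {0..S} \<Longrightarrow> (q has_real_derivative c\<^sup>2 * v t (q t)) (at t within {0..})"
    using characteristic[OF \<open>S \<ge> 0\<close>] by blast
  obtain M where "M \<ge> 0" and M: "\<And>t x. t \<in> {0..S} \<Longrightarrow> \<bar>v t x\<bar> \<le> M" "\<And>t x. t \<in> {0..S} \<Longrightarrow> \<bar>vx t x\<bar> \<le> M"
    using bounded_on_compact[OF \<open>S \<ge> 0\<close>] by blast
  define V where "V = (\<lambda>t. v t (q t))"
  define m where "m = (\<lambda>t. vx t (q t))"
  define l where "l = (\<lambda>t. left_average c (source t) (q t))"
  define r where "r = (\<lambda>t. right_average c (source t) (q t))"
  define m' where "m' = (\<lambda>t. force_deriv t (q t) - c\<^sup>2 * (m t)\<^sup>2)"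
  have V_deriv: "(V has_real_derivative force t (q t)) (at t within {0..S})" if t: "t \<in> {0..S}" for t
  proof -
    have "(V has_real_derivative force t (q t)) (at t within {0..})"
      unfolding V_def using transport_derivative[OF _ q[OF t]] t by (simp add: mult_ac)
    then show ?thesis
      by (rule DERIV_subset) auto
  qed
  have m_deriv: "(m has_real_derivative m' t) (at t within {0..S})" if t: "t \<in> {0..S}" for t
    unfolding m_def m'_def by (rule slope_along_characteristic[OF \<open>S \<ge> 0\<close> q t])
  have lr: "c\<^sup>2 / 4 * (V t)\<^sup>2 \<le> l t" "c\<^sup>2 / 4 * (V t)\<^sup>2 \<le> r t" if t: "t \<in> {0..S}" for t
  proof -
    have "t \<ge> 0"
      using t by simp
    have src: "source t = (\<lambda>y. c\<^sup>2 * (v t y)\<^sup>2 + (c\<^sup>2)\<^sup>2 / 2 * (vx t y)\<^sup>2)"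
      by (rule ext) (simp add: quadratic_source_def)
    show "c\<^sup>2 / 4 * (V t)\<^sup>2 \<le> l t"
      unfolding V_def l_def src
      by (rule left_average_lower_bound[OF c_pos space_deriv[OF \<open>t \<ge> 0\<close>] vx_cont[OF \<open>t \<ge> 0\<close>] M(1)[OF t] M(2)[OF t]])
    show "c\<^sup>2 / 4 * (V t)\<^sup>2 \<le> r t"
      unfolding V_def r_def src
      by (rule right_average_lower_bound[OF c_pos space_deriv[OF \<open>t \<ge> 0\<close>] vx_cont[OF \<open>t \<ge> 0\<close>] M(1)[OF t] M(2)[OF t]])
  qed
  \<comment> \<open>The remainders are nonnegative by the lower bounds for the two averages.\<close>
  have rate: "force t (q t) / c - m' t = k * ((m t)\<^sup>2 - (V t)\<^sup>2 / c\<^sup>2) + 2 / c\<^sup>2 * (l t - c\<^sup>2 / 4 * (V t)\<^sup>2)"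
    "- force t (q t) / c - m' t = k * ((m t)\<^sup>2 - (V t)\<^sup>2 / c\<^sup>2) + 2 / c\<^sup>2 * (r t - c\<^sup>2 / 4 * (V t)\<^sup>2)" for t
    unfolding m'_def force_deriv_def nonlocal_force_def quadratic_source_def[of c "v t" "vx t" "q t"] l_def[symmetric] r_def[symmetric] k_def
    using c_pos by (simp_all add: l_def r_def V_def m_def field_simps power2_eq_square)
  have product: "(V t / c - m t) * (- V t / c - m t) = (m t)\<^sup>2 - (V t)\<^sup>2 / c\<^sup>2" for t
    by (simp add: algebra_simps power2_eq_square)
  have "2 * k * S < 1 / (V 0 / c - m 0) + 1 / (- V 0 / c - m 0)"
  proof (rule coupled_growth_blowup[OF \<open>S \<ge> 0\<close> \<open>k > 0\<close>])
    fix t assume t: "t \<in> {0..S}"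
    show "((\<lambda>t. V t / c - m t) has_real_derivative force t (q t) / c - m' t) (at t within {0..S})"
      by (intro DERIV_diff DERIV_cdivide V_deriv m_deriv t)
    show "((\<lambda>t. - V t / c - m t) has_real_derivative - force t (q t) / c - m' t) (at t within {0..S})"
      by (intro DERIV_diff DERIV_cdivide DERIV_minus V_deriv m_deriv t)
    show "k * ((V t / c - m t) * (- V t / c - m t)) \<le> force t (q t) / c - m' t"
      unfolding product rate using lr[OF t] by simp
    show "k * ((V t / c - m t) * (- V t / c - m t)) \<le> - force t (q t) / c - m' t"
      unfolding product rate using lr[OF t] by simp
  qed (use pos in \<open>simp_all add: V_def m_def q0\<close>)
  also have "\<dots> = 2 * k * S"
    using \<open>k > 0\<close> by (simp add: S_def V_def m_def q0)
  finally show False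
    by simp
qed

end

section \<open>Strong solutions are classical\<close>

lemma helmholtz_inverse_has_derivative:
  assumes "d \<ge> 1" and cont: "continuous_on UNIV f" and M: "\<And>x. \<bar>f x\<bar> \<le> M"
  shows "(helmholtz_inverse d f has_real_derivative
      (right_average (sqrt (real d)) f x - left_average (sqrt (real d)) f x) / sqrt (real d)) (at x)"
proof -
  define c where "c = sqrt (real d)"
  have "c > 0"
    using assms(1) by (simp add: c_def)
  have eq: "helmholtz_inverse d f = (\<lambda>x. left_average c f x + right_average c f x)"
    unfolding c_def by (rule ext, rule helmholtz_inverse_eq_averages[OF \<open>d \<ge> 1\<close> borel_measurable_continuous_onI[OF cont] M])
  have "((\<lambda>x. left_average c f x + right_average c f x) has_real_derivative
      (f x / (2 * c) - left_average c f x / c) + (right_average c f x / c - f x / (2 * c))) (at x)"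
    by (intro DERIV_add left_average_has_derivative[OF \<open>c > 0\<close> cont M] right_average_has_derivative[OF \<open>c > 0\<close> cont M])
  then show ?thesis
    unfolding eq c_def[symmetric] by (simp add: diff_divide_distrib)
qed

lemma nonlocal_force_continuous:
  assumes "c > 0" and u: "continuous_on UNIV u" and u': "continuous_on UNIV u'"
    and M: "\<And>x. \<bar>u x\<bar> \<le> M" and M': "\<And>x. \<bar>u' x\<bar> \<le> M'"
  obtains B where "continuous_on UNIV (quadratic_source c u u')" "\<And>x. \<bar>quadratic_source c u u' x\<bar> \<le> B"
    and "continuous_on UNIV (nonlocal_force c u u')"
proof -
  define B where "B = c\<^sup>2 * M\<^sup>2 + (c\<^sup>2)\<^sup>2 / 2 * M'\<^sup>2"
  have cont: "continuous_on UNIV (quadratic_source c u u')"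
    unfolding quadratic_source_def[abs_def] by (intro continuous_intros u u')
  have bound: "\<bar>quadratic_source c u u' x\<bar> \<le> B" for x
  proof -
    have "(u x)\<^sup>2 \<le> M\<^sup>2" "(u' x)\<^sup>2 \<le> M'\<^sup>2"
      using M[of x] M'[of x] by (simp_all add: abs_le_square_iff[symmetric])
    then show ?thesis
      unfolding quadratic_source_def B_def by (simp add: add_mono mult_left_mono)
  qed
  have "continuous_on UNIV (left_average c (quadratic_source c u u'))"
    by (rule DERIV_continuous_on, rule has_field_derivative_at_within, rule left_average_has_derivative[OF \<open>c > 0\<close> cont bound])
  moreover have "continuous_on UNIV (right_average c (quadratic_source c u u'))"
    by (rule DERIV_continuous_on, rule has_field_derivative_at_within, rule right_average_has_derivative[OF \<open>c > 0\<close> cont bound])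
  ultimately have "continuous_on UNIV (nonlocal_force c u u')"
    unfolding nonlocal_force_def[abs_def] using \<open>c > 0\<close> by (intro continuous_intros) auto
  with cont bound show thesis
    by (rule that)
qed

lemma C1_real_derivative:
  fixes f :: "real \<Rightarrow> real"
  assumes "f C1_differentiable_on UNIV"
  shows "(f has_real_derivative deriv f x) (at x)" and "continuous_on UNIV (deriv f)"
proof -
  obtain D where D: "\<And>x. (f has_vector_derivative D x) (at x)" and cont: "continuous_on UNIV D"
    using assms unfolding C1_differentiable_on_def by auto
  have D': "(f has_real_derivative D x) (at x)" for x
    using D by (simp add: has_real_derivative_iff_has_vector_derivative)
  then have "deriv f = D"
    by (intro ext DERIV_imp_deriv)
  with D' cont show "(f has_real_derivative deriv f x) (at x)" "continuous_on UNIV (deriv f)"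
    by simp_all
qed

lemma sobolev_diff: "f \<in> sobolev s \<Longrightarrow> g \<in> sobolev s \<Longrightarrow> (\<lambda>x. f x - g x) \<in> sobolev s"
  using sobolev_linear_combination[of f s g 1 "- 1"] by simp

lemma eventually_le_of_tendsto_0:
  fixes N :: "'a \<Rightarrow> real"
  assumes "(N \<longlongrightarrow> 0) F" "e > 0"
  shows "\<forall>\<^sub>F \<tau> in F. C * N \<tau> \<le> e"
proof -
  have "((\<lambda>\<tau>. C * N \<tau>) \<longlongrightarrow> 0) F"
    using tendsto_mult_left[OF assms(1), of C] by simp
  then have "\<forall>\<^sub>F \<tau> in F. C * N \<tau> < e"
    using \<open>e > 0\<close> by (rule order_tendstoD(2))
  then show ?thesis
    by (rule eventually_mono) simp
qed

text \<open>The embedding of \<open>H\<^sup>s\<close> controls \<open>v\<close> and its space derivative, since \<open>s > 3/2\<close>; the embedding of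
\<open>H\<^sup>s\<^sup>-\<^sup>1\<close> controls the time difference quotients, since \<open>s - 1 > 1/2\<close>. The time derivative \<open>w\<close> is
known only almost everywhere in \<open>x\<close>, but the equation identifies it with a continuous function.\<close>

lemma strong_solution_imp_classical_solution:
  assumes "d \<ge> 1" "s > 3 / 2" and sol: "strong_solution d s v0 \<infinity> v"
  shows "classical_solution (sqrt (real d)) v (\<lambda>t. deriv (v t))"
proof -
  define c where "c = sqrt (real d)"
  have "c > 0" and c2: "c\<^sup>2 = real d"
    using \<open>d \<ge> 1\<close> by (simp_all add: c_def)
  have interval: "time_interval \<infinity> = {0..}"
    by (auto simp: time_interval_def)
  have C1: "v t C1_differentiable_on UNIV" if "t \<ge> 0" for t
    using sol that by (simp add: strong_solution_def interval)
  have cont_v: "continuous_into_sobolev s {0..} v"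
    using sol by (simp add: strong_solution_def interval)
  obtain w where w: "has_sobolev_time_derivative (s - 1) {0..} v w"
    and equation: "\<And>t. t \<ge> 0 \<Longrightarrow> AE x in lborel. w t x + real d * v t x * deriv (v t) x =
           - deriv (helmholtz_inverse d (\<lambda>y. real d * (v t y)\<^sup>2 + (real d)\<^sup>2 / 2 * (deriv (v t) y)\<^sup>2)) x"
    using sol by (auto simp: strong_solution_def interval)
  have v_sob: "v t \<in> sobolev s" if "t \<ge> 0" for t
    using cont_v that by (simp add: continuous_into_sobolev_def)
  have lim_v: "((\<lambda>\<tau>. sobolev_norm s (\<lambda>x. v \<tau> x - v t x)) \<longlongrightarrow> 0) (at t within {0..})" if "t \<ge> 0" for t
    using cont_v that by (simp add: continuous_into_sobolev_def)
  have vd: "(v t has_real_derivative deriv (v t) x) (at x)" if "t \<ge> 0" for t x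
    by (rule C1_real_derivative(1)[OF C1[OF that]])
  have vd_cont: "continuous_on UNIV (deriv (v t))" if "t \<ge> 0" for t
    by (rule C1_real_derivative(2)[OF C1[OF that]])
  have v_cont: "continuous_on UNIV (v t)" if "t \<ge> 0" for t
    by (rule DERIV_continuous_on[OF has_field_derivative_at_within[OF vd[OF that]]])
  have v_bound: "\<bar>v t x\<bar> \<le> sobolev_constant s * sobolev_norm s (v t)" if "t \<ge> 0" for t x
    using \<open>s > 3 / 2\<close> by (intro sobolev_bound[OF v_sob[OF that] _ _ v_cont[OF that]]) simp_all
  have vd_bound: "\<bar>deriv (v t) x\<bar> \<le> sobolev_constant (s - 1) * sobolev_norm s (v t)" if "t \<ge> 0" for t x
    by (rule sobolev_deriv_bound[OF v_sob[OF that] \<open>s > 3 / 2\<close>])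
       (use vd[OF that] in \<open>auto simp: real_differentiable_def\<close>)
  show ?thesis
    unfolding c_def[symmetric]
  proof
    show "c > 0" by fact
    show "(v t has_real_derivative deriv (v t) x) (at x)" if "t \<ge> 0" for t x
      by (rule vd[OF that])
    show "continuous_on UNIV (deriv (v t))" if "t \<ge> 0" for t
      by (rule vd_cont[OF that])
    show "\<exists>M. \<forall>x. \<bar>v t x\<bar> \<le> M" if "t \<ge> 0" for t
      using v_bound[OF that] by blast
    show "\<exists>M. \<forall>x. \<bar>deriv (v t) x\<bar> \<le> M" if "t \<ge> 0" for t
      using vd_bound[OF that] by blast
  next
    fix t e :: real assume t: "t \<ge> 0" and "e > 0"
    have ev0: "\<forall>\<^sub>F \<tau> in at t within {0..}. \<tau> \<ge> 0 \<and> \<tau> \<noteq> t"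
      by (auto simp: eventually_at_filter)
    show "\<forall>\<^sub>F \<tau> in at t within {0..}. \<forall>x. \<bar>v \<tau> x - v t x\<bar> \<le> e"
      using eventually_le_of_tendsto_0[OF lim_v[OF t] \<open>e > 0\<close>, of "sobolev_constant s"] ev0
    proof eventually_elim
      case (elim \<tau>)
      have "\<bar>v \<tau> x - v t x\<bar> \<le> sobolev_constant s * sobolev_norm s (\<lambda>x. v \<tau> x - v t x)" for x
        by (rule sobolev_bound) (use elim t \<open>s > 3 / 2\<close> in \<open>auto intro!: sobolev_diff v_sob continuous_intros v_cont\<close>)
      with elim(1) show ?case
        by (meson order.trans)
    qed
    show "\<forall>\<^sub>F \<tau> in at t within {0..}. \<forall>x. \<bar>deriv (v \<tau>) x - deriv (v t) x\<bar> \<le> e"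
      using eventually_le_of_tendsto_0[OF lim_v[OF t] \<open>e > 0\<close>, of "sobolev_constant (s - 1)"] ev0
    proof eventually_elim
      case (elim \<tau>)
      then have "\<tau> \<ge> 0" by simp
      have D: "((\<lambda>x. v \<tau> x - v t x) has_real_derivative deriv (v \<tau>) x - deriv (v t) x) (at x)" for x
        by (intro DERIV_diff vd \<open>\<tau> \<ge> 0\<close> t)
      have "\<bar>deriv (\<lambda>x. v \<tau> x - v t x) x\<bar> \<le> sobolev_constant (s - 1) * sobolev_norm s (\<lambda>x. v \<tau> x - v t x)" for x
        by (rule sobolev_deriv_bound[OF sobolev_diff[OF v_sob[OF \<open>\<tau> \<ge> 0\<close>] v_sob[OF t]] \<open>s > 3 / 2\<close>])
           (use D in \<open>auto simp: real_differentiable_def\<close>)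
      with elim(1) show ?case
        unfolding DERIV_imp_deriv[OF D] by (meson order.trans)
    qed
    obtain B where source: "continuous_on UNIV (quadratic_source c (v t) (deriv (v t)))"
        "\<And>x. \<bar>quadratic_source c (v t) (deriv (v t)) x\<bar> \<le> B"
      and force: "continuous_on UNIV (nonlocal_force c (v t) (deriv (v t)))"
      using nonlocal_force_continuous[OF \<open>c > 0\<close> v_cont[OF t] vd_cont[OF t] v_bound[OF t] vd_bound[OF t]] by blast
    define W where "W = (\<lambda>x. nonlocal_force c (v t) (deriv (v t)) x - c\<^sup>2 * v t x * deriv (v t) x)"
    have W_cont: "continuous_on UNIV W"
      unfolding W_def by (intro continuous_intros force v_cont vd_cont t)
    have source_eq: "(\<lambda>y. real d * (v t y)\<^sup>2 + (real d)\<^sup>2 / 2 * (deriv (v t) y)\<^sup>2) = quadratic_source c (v t) (deriv (v t))"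
      by (rule ext) (simp add: quadratic_source_def c2)
    have "- deriv (helmholtz_inverse d (quadratic_source c (v t) (deriv (v t)))) x = nonlocal_force c (v t) (deriv (v t)) x" for x
      using DERIV_imp_deriv[OF helmholtz_inverse_has_derivative[OF \<open>d \<ge> 1\<close> source, of x]]
      by (simp add: nonlocal_force_def c_def[symmetric] diff_divide_distrib)
    then have w_AE: "AE x in lborel. w t x = W x"
      using equation[OF t] unfolding source_eq
      by (auto simp: W_def c2 elim!: eventually_mono)
    have v_sob': "v \<tau> \<in> sobolev (s - 1)" "w \<tau> \<in> sobolev (s - 1)" if "\<tau> \<ge> 0" for \<tau>
      using w that by (simp_all add: has_sobolev_time_derivative_def)
    have lim_w: "((\<lambda>\<tau>. sobolev_norm (s - 1) (\<lambda>x. (v \<tau> x - v t x) / (\<tau> - t) - w t x)) \<longlongrightarrow> 0) (at t within {0..})"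
      using w t by (simp add: has_sobolev_time_derivative_def)
    show "\<forall>\<^sub>F \<tau> in at t within {0..}. \<forall>x. \<bar>(v \<tau> x - v t x) / (\<tau> - t)
        - (nonlocal_force c (v t) (deriv (v t)) x - c\<^sup>2 * v t x * deriv (v t) x)\<bar> \<le> e"
      using eventually_le_of_tendsto_0[OF lim_w \<open>e > 0\<close>, of "sobolev_constant (s - 1)"] ev0
    proof eventually_elim
      case (elim \<tau>)
      then have "\<tau> \<ge> 0" "\<tau> \<noteq> t" by simp_all
      have "(\<lambda>x. (1 / (\<tau> - t)) * v \<tau> x + (- 1 / (\<tau> - t)) * v t x) \<in> sobolev (s - 1)"
        by (intro sobolev_linear_combination v_sob' \<open>\<tau> \<ge> 0\<close> t)
      then have "(\<lambda>x. (v \<tau> x - v t x) / (\<tau> - t)) \<in> sobolev (s - 1)"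
        by (simp add: diff_divide_distrib)
      then have sob: "(\<lambda>x. (v \<tau> x - v t x) / (\<tau> - t) - w t x) \<in> sobolev (s - 1)"
        by (rule sobolev_diff) (rule v_sob'(2)[OF t])
      have "\<bar>(v \<tau> x - v t x) / (\<tau> - t) - W x\<bar>
          \<le> sobolev_constant (s - 1) * sobolev_norm (s - 1) (\<lambda>x. (v \<tau> x - v t x) / (\<tau> - t) - w t x)" for x
      proof (rule sobolev_bound[OF sob, where h = "\<lambda>x. (v \<tau> x - v t x) / (\<tau> - t) - W x"])
        show "AE x in lborel. (v \<tau> x - v t x) / (\<tau> - t) - w t x = (v \<tau> x - v t x) / (\<tau> - t) - W x"
          using w_AE by eventually_elim simp
        show "continuous_on UNIV (\<lambda>x. (v \<tau> x - v t x) / (\<tau> - t) - W x)"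
          using \<open>\<tau> \<noteq> t\<close> by (intro continuous_intros v_cont W_cont \<open>\<tau> \<ge> 0\<close> t) simp
      qed (use \<open>s > 3 / 2\<close> in simp)
      with elim(1) show ?case
        unfolding W_def by (meson order.trans)
    qed
  qed
qed

theorem theorem1p3:
  fixes d :: nat and s x0 :: real and v0 :: "real \<Rightarrow> real"
    and T :: ereal and v :: "real \<Rightarrow> real \<Rightarrow> real"
  assumes "d \<ge> 1"
    and "s > 3 / 2"
    and "v0 \<in> sobolev s"
    and "v0 C1_differentiable_on UNIV"
    and "deriv v0 x0 < - (1 / sqrt (real d)) * \<bar>v0 x0\<bar>"
    and "maximal_strong_solution d s v0 T v"
  shows "T < \<infinity>"
proof (rule ccontr)
  assume "\<not> T < \<infinity>"
  then have "T = \<infinity>"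
    by simp
  with assms(6) have sol: "strong_solution d s v0 \<infinity> v"
    by (simp add: maximal_strong_solution_def)
  then have "v 0 = v0"
    by (simp add: strong_solution_def)
  interpret classical_solution "sqrt (real d)" v "\<lambda>t. deriv (v t)"
    by (rule strong_solution_imp_classical_solution[OF assms(1,2) sol])
  show False
    using no_global_solution[of x0] assms(5) by (simp add: \<open>v 0 = v0\<close>)
qed

end
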